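(* Let $k\in\mathbb{N}$. Then for integers $d>k+2$, the $k$-th derivatives of the cardinal B-splines satisfy \[ \left(\frac{d}{12}\right)^{\frac{k+1}{2}}B^{(k)}_{d}\left(\sqrt{\frac{d}{12}}\,x+\frac{d}{2}\right) =\frac{1}{\sqrt{2\pi}}\, D^k\exp\left(-\frac{x^2}{2}\right)+O\left(\frac{1}{d}\right)\quad (d\to\infty), \] and \[ \lim_{d\rightarrow\infty}\left(\frac{d}{12}\right)^{\frac{k+1}{2}}B^{(k)}_{d}\left(\sqrt{\frac{d}{12}}\,x+\frac{d}{2}\right) =\frac{1}{\sqrt{2\pi}}\, D^k\exp\left(-\frac{x^2}{2}\right), \] where the limit may be taken point-wise or in $L^p(\mathbb{R})$ for $p\in[2,\infty)$.
   Context: The B-spline of order $d$ is defined inductively by $B_1(x)=1$ for $x\in[0,1)$ and $B_1(x)=0$ otherwise, and $B_d=B_1*B_{d-1}$ for $d\ge 2$, where $(f*g)(t)=\int_{-\infty}^{\infty}f(t-y)g(y)\,dy$. Equivalently $B_d(x)=\frac{1}{(d-1)!}\sum_{i=0}^{d}(-1)^i\binom{d}{i}(x-i)_+^{d-1}$ with $x_+^m=x^m$ for $x\ge0$ and $0$ otherwise; $B_d$ is supported on $[0,d]$ and lies in $C^{d-1}(\mathbb{R})$. $B^{(k)}_d$ denotes the $k$-th derivative of $B_d$, and $D^k$ denotes the $k$-th derivative with respect to $x$. *)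

theory Defs
  imports "HOL-Analysis.Analysis"
begin

definition fun_convolution :: "(real \<Rightarrow> real) \<Rightarrow> (real \<Rightarrow> real) \<Rightarrow> real \<Rightarrow> real" where
  "fun_convolution f g t = (LINT y|lborel. f (t - y) * g y)"

text \<open>The order of a B-spline is at least 1; the value at order 0 is a dummy.\<close>

fun bspline :: "nat \<Rightarrow> real \<Rightarrow> real" where
  "bspline 0 = (\<lambda>x. 0)"
| "bspline (Suc 0) = indicator {0..<1}"
| "bspline (Suc (Suc d)) = fun_convolution (bspline (Suc 0)) (bspline (Suc d))"

definition rescaled_bspline_deriv :: "nat \<Rightarrow> nat \<Rightarrow> real \<Rightarrow> real" where
  "rescaled_bspline_deriv k d x =
     (real d / 12) powr ((real k + 1) / 2) *
       (deriv ^^ k) (bspline d) (sqrt (real d / 12) * x + real d / 2)"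

text \<open>Membership and convergence in \<open>L\<^sup>p\<close> of a measure space for a real exponent \<open>p\<close>
  (meant for \<open>p \<ge> 1\<close>), in terms of functions rather than almost-everywhere classes.
  Membership is required explicitly because the Bochner integral of a
  non-integrable function is 0.\<close>

definition in_Lp :: "real \<Rightarrow> 'a measure \<Rightarrow> ('a \<Rightarrow> real) \<Rightarrow> bool" where
  "in_Lp p M f \<longleftrightarrow> f \<in> borel_measurable M \<and> integrable M (\<lambda>x. \<bar>f x\<bar> powr p)"

definition Lp_norm :: "real \<Rightarrow> 'a measure \<Rightarrow> ('a \<Rightarrow> real) \<Rightarrow> real" where
  "Lp_norm p M f = (LINT x|M. \<bar>f x\<bar> powr p) powr (1 / p)"

definition converges_in_Lp ::
    "real \<Rightarrow> 'a measure \<Rightarrow> (nat \<Rightarrow> 'a \<Rightarrow> real) \<Rightarrow> ('a \<Rightarrow> real) \<Rightarrow> bool" where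
  "converges_in_Lp p M F f \<longleftrightarrow>
     in_Lp p M f \<and> (\<forall>\<^sub>F n in sequentially. in_Lp p M (F n)) \<and>
     (\<lambda>n. Lp_norm p M (\<lambda>x. F n x - f x)) \<longlonglongrightarrow> 0"

end

theory Submission
  imports Defs "HOL-Probability.Probability" "HOL-Real_Asymp.Real_Asymp"
begin

text \<open>Fourier inversion writes the rescaled derivative of \<open>B\<^sub>d\<close> and the derivative of the Gaussian as
  cosine integrals of \<open>u ^ k\<close> against \<open>sinc (u * sqrt (3 / d)) ^ d\<close> and \<open>exp (- u\<^sup>2 / 2)\<close>. These two weights
  differ by \<open>O(1 / d)\<close> even after multiplication by \<open>u ^ k * (1 + u\<^sup>2)\<close>, which gives the uniform rate.
  Plancherel's theorem is avoided for the \<open>L\<^sup>p\<close> statement: if \<open>g\<close> is the difference for \<open>k = 0\<close>,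
  then integration by parts gives \<open>\<integral> (g\<^sup>(\<^sup>k\<^sup>))\<^sup>2 = \<plusminus> \<integral> g g\<^sup>(\<^sup>2\<^sup>k\<^sup>) \<le> 2 sup \<bar>g\<^sup>(\<^sup>2\<^sup>k\<^sup>)\<bar>\<close>, because both
  functions are probability densities, and the right-hand side is \<open>O(1 / d)\<close>. For \<open>p > 2\<close> one interpolates
  with the uniform bound.\<close>

section \<open>Functions of quadratic decay\<close>

text \<open>The majorant is integrable with integral \<open>C * pi\<close>, dominates every function
  that occurs here and survives sums and products. No sign of \<open>C\<close> is required, since
  \<open>x = 0\<close> forces \<open>0 \<le> C\<close>.\<close>

definition quad_decay :: "(real \<Rightarrow> real) \<Rightarrow> bool" where
  "quad_decay f \<longleftrightarrow> (\<exists>C. \<forall>x. \<bar>f x\<bar> \<le> C / (1 + x\<^sup>2))"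

lemma one_plus_square_pos: "0 < 1 + (x::real)\<^sup>2"
  by (rule add_pos_nonneg) auto

lemma quad_decayI: "(\<And>x. \<bar>f x\<bar> \<le> C / (1 + x\<^sup>2)) \<Longrightarrow> quad_decay f"
  unfolding quad_decay_def by blast

lemma integrable_inverse_one_plus_square: "integrable lborel (\<lambda>x::real. C / (1 + x\<^sup>2))"
  using integrable_inverse_1_plus_square
  by (auto simp: set_integrable_def einterval_eq_UNIV divide_inverse)

lemma integral_inverse_one_plus_square: "(LINT x|lborel. C / (1 + x\<^sup>2)) = C * pi"
proof -
  have "(LINT x|lborel. inverse (1 + x\<^sup>2)) = pi"
    using LBINT_inverse_1_plus_square
    by (simp add: interval_lebesgue_integral_def set_lebesgue_integral_def)
  then show ?thesis
    using integrable_inverse_one_plus_square[of 1] by (simp add: divide_inverse)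
qed

lemma quad_decay_integrable:
  assumes "quad_decay f" and [measurable]: "f \<in> borel_measurable borel"
  shows "integrable lborel f"
proof -
  obtain C where C: "\<And>x. \<bar>f x\<bar> \<le> C / (1 + x\<^sup>2)" using assms(1) unfolding quad_decay_def by blast
  have "norm (f x) \<le> norm (C / (1 + x\<^sup>2))" for x
    unfolding real_norm_def by (rule order_trans[OF C abs_ge_self])
  then show ?thesis
    by (intro Bochner_Integration.integrable_bound[OF integrable_inverse_one_plus_square[of C]] AE_I2) auto
qed

lemma quad_decay_add:
  assumes "quad_decay f" "quad_decay g" shows "quad_decay (\<lambda>x. f x + g x)"
proof -
  obtain C D where "\<And>x. \<bar>f x\<bar> \<le> C / (1 + x\<^sup>2)" "\<And>x. \<bar>g x\<bar> \<le> D / (1 + x\<^sup>2)"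
    using assms unfolding quad_decay_def by blast
  then show ?thesis
    by (intro quad_decayI[of _ "C + D"]) (simp add: add_divide_distrib order_trans[OF abs_triangle_ineq add_mono])
qed

lemma quad_decay_cmult:
  assumes "quad_decay f" shows "quad_decay (\<lambda>x. c * f x)"
proof -
  obtain C where "\<And>x. \<bar>f x\<bar> \<le> C / (1 + x\<^sup>2)"
    using assms unfolding quad_decay_def by blast
  then have "\<bar>c * f x\<bar> \<le> (\<bar>c\<bar> * C) / (1 + x\<^sup>2)" for x
    using mult_left_mono[of "\<bar>f x\<bar>" "C / (1 + x\<^sup>2)" "\<bar>c\<bar>"] by (simp add: abs_mult)
  then show ?thesis by (rule quad_decayI)
qed

lemma quad_decay_diff:
  "quad_decay f \<Longrightarrow> quad_decay g \<Longrightarrow> quad_decay (\<lambda>x. f x - g x)"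
  using quad_decay_add[of f "\<lambda>x. -1 * g x"] quad_decay_cmult[of g "-1"] by simp

lemma quad_decay_mono:
  assumes "quad_decay g" "\<And>x. \<bar>f x\<bar> \<le> \<bar>g x\<bar>" shows "quad_decay f"
proof -
  obtain C where C: "\<And>x. \<bar>g x\<bar> \<le> C / (1 + x\<^sup>2)" using assms(1) unfolding quad_decay_def by blast
  show ?thesis by (rule quad_decayI[of _ C], rule order_trans[OF assms(2) C])
qed

lemma quad_decay_bounded:
  assumes "quad_decay f" obtains C where "\<And>x. \<bar>f x\<bar> \<le> C"
proof -
  obtain C where C: "\<And>x. \<bar>f x\<bar> \<le> C / (1 + x\<^sup>2)" using assms unfolding quad_decay_def by blast
  have "0 \<le> C" using C[of 0] by simp
  then have "C / (1 + x\<^sup>2) \<le> C" for x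
    by (simp add: divide_le_eq one_plus_square_pos mult_le_cancel_left1)
  then have "\<bar>f x\<bar> \<le> C" for x using order_trans[OF C] by blast
  then show ?thesis by (rule that)
qed

lemma quad_decay_mult:
  assumes "quad_decay f" "quad_decay g" shows "quad_decay (\<lambda>x. f x * g x)"
proof -
  obtain C where C: "\<And>x. \<bar>f x\<bar> \<le> C" using quad_decay_bounded[OF assms(1)] by metis
  have "0 \<le> C" using C[of 0] by linarith
  show ?thesis
    by (rule quad_decay_mono[OF quad_decay_cmult[OF assms(2), of C]])
      (use C \<open>0 \<le> C\<close> in \<open>auto simp: abs_mult intro!: mult_right_mono\<close>)
qed

text \<open>Stated for any filter below \<open>at_infinity\<close>, so that it supplies the boundary
  terms at both ends of the line.\<close>

lemma quad_decay_tendsto_0: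
  assumes "quad_decay f" "F \<le> at_infinity" shows "(f \<longlongrightarrow> 0) F"
proof -
  obtain C where C: "\<And>x. \<bar>f x\<bar> \<le> C / (1 + x\<^sup>2)" using assms(1) unfolding quad_decay_def by blast
  have "((\<lambda>x::real. C / (1 + x\<^sup>2)) \<longlongrightarrow> 0) at_top" "((\<lambda>x::real. C / (1 + x\<^sup>2)) \<longlongrightarrow> 0) at_bot"
    by real_asymp+
  then have "((\<lambda>x::real. C / (1 + x\<^sup>2)) \<longlongrightarrow> 0) at_infinity"
    by (simp add: at_infinity_eq_at_top_bot filterlim_sup)
  then have "((\<lambda>x::real. C / (1 + x\<^sup>2)) \<longlongrightarrow> 0) F" using assms(2) by (rule tendsto_mono[rotated])
  then show ?thesis by (rule Lim_null_comparison[rotated]) (use C in auto)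
qed

text \<open>After multiplication by \<open>1 + x\<^sup>2\<close> the function still tends to 0 at
  infinity, hence is bounded on the half-line by continuity on a compact interval. Its absolute
  value is even, which covers negative \<open>x\<close>.\<close>

lemma quad_decay_gaussian:
  assumes "c > 0" shows "quad_decay (\<lambda>x. x ^ n * exp (- (c * x\<^sup>2)))"
proof -
  have 1: "((\<lambda>x. (1 + x\<^sup>2) * (x ^ n * exp (- (c * x\<^sup>2)))) \<longlongrightarrow> 0) at_top"
    using assms by real_asymp
  have 2: "continuous_on {0..} (\<lambda>x. (1 + x\<^sup>2) * (x ^ n * exp (- (c * x\<^sup>2))))"
    by (intro continuous_intros)
  from 1 have "eventually (\<lambda>x. \<bar>(1 + x\<^sup>2) * (x ^ n * exp (- (c * x\<^sup>2)))\<bar> < 1) at_top"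
    using tendstoD[OF 1, of 1] by (simp add: dist_real_def)
  then obtain N where N: "\<And>x. x \<ge> N \<Longrightarrow> \<bar>(1 + x\<^sup>2) * (x ^ n * exp (- (c * x\<^sup>2)))\<bar> < 1"
    by (auto simp: eventually_at_top_linorder)
  have "bounded ((\<lambda>x. (1 + x\<^sup>2) * (x ^ n * exp (- (c * x\<^sup>2)))) ` {0..N})"
    by (rule compact_imp_bounded[OF compact_continuous_image[OF continuous_on_subset[OF 2]]]) auto
  then obtain B where "\<forall>y \<in> (\<lambda>x. (1 + x\<^sup>2) * (x ^ n * exp (- (c * x\<^sup>2)))) ` {0..N}. norm y \<le> B"
    unfolding bounded_iff by blast
  then have B: "\<bar>(1 + x\<^sup>2) * (x ^ n * exp (- (c * x\<^sup>2)))\<bar> \<le> B" if "x \<in> {0..N}" for x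
    unfolding real_norm_def[symmetric] using that by blast
  have pos: "\<bar>(1 + x\<^sup>2) * (x ^ n * exp (- (c * x\<^sup>2)))\<bar> \<le> max B 1" if "x \<ge> 0" for x
    using that N[of x] B[of x] by (cases "x \<le> N") auto
  have all: "(1 + x\<^sup>2) * \<bar>x ^ n * exp (- (c * x\<^sup>2))\<bar> \<le> max B 1" for x
    using pos[of "\<bar>x\<bar>"] one_plus_square_pos[of x] by (simp add: abs_mult power_abs)
  show ?thesis
    by (rule quad_decayI[of _ "max B 1"])
      (use all one_plus_square_pos in \<open>simp add: pos_le_divide_eq mult.commute\<close>)
qed

section \<open>Cosine transforms and their derivatives\<close>

text \<open>The phase \<open>k \<pi> / 2\<close> encodes the \<open>k\<close>-th derivative of the cosine.\<close>

definition cos_transform :: "(real \<Rightarrow> real) \<Rightarrow> nat \<Rightarrow> real \<Rightarrow> real" where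
  "cos_transform g k x = (LINT t|lborel. g t * t ^ k * cos (t * x + real k * pi / 2))"

text \<open>Since \<open>cos (a + pi / 2) = - sin a\<close>, this is the first-order Taylor estimate
  of the cosine with a remainder uniform in \<open>a\<close>. The addition theorem reduces it to the
  remainders of \<open>cos\<close> and \<open>sin\<close> at 0, each at most
  \<open>b\<^sup>2 / 2\<close>.\<close>

lemma cos_taylor_2: "\<bar>cos (a + b) - cos a - b * cos (a + pi / 2)\<bar> \<le> b\<^sup>2" for a b :: real
proof -
  have c: "\<bar>1 - cos b\<bar> \<le> b\<^sup>2 / 2"
  proof -
    have "1 - cos b = 2 * (sin (b / 2))\<^sup>2" using cos_double_sin[of "b / 2"] by simp
    moreover have "(sin (b / 2))\<^sup>2 \<le> (b / 2)\<^sup>2" using abs_sin_x_le_abs_x[of "b / 2"] by (simp only: abs_le_square_iff)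
    ultimately show ?thesis by (simp add: power_divide)
  qed
  have s: "\<bar>sin b - b\<bar> \<le> b\<^sup>2 / 2"
    using Maclaurin_sin_bound[of b 2] by (simp add: numeral_2_eq_2 sin_coeff_def)
  have eq: "cos (a + b) - cos a - b * cos (a + pi / 2) = - cos a * (1 - cos b) - sin a * (sin b - b)"
    by (simp add: cos_add algebra_simps)
  have "\<bar>- cos a * (1 - cos b) - sin a * (sin b - b)\<bar> \<le> \<bar>cos a\<bar> * \<bar>1 - cos b\<bar> + \<bar>sin a\<bar> * \<bar>sin b - b\<bar>"
    unfolding abs_mult[symmetric] using abs_triangle_ineq4[of "- cos a * (1 - cos b)"] by simp
  also have "\<dots> \<le> 1 * (b\<^sup>2 / 2) + 1 * (b\<^sup>2 / 2)"
    using c s by (intro add_mono mult_mono) auto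
  finally show ?thesis unfolding eq by simp
qed

lemma integrable_times_cos:
  fixes h :: "real \<Rightarrow> real"
  assumes "integrable lborel h"
  shows "integrable lborel (\<lambda>t. h t * cos (t * x + c))"
  by (rule Bochner_Integration.integrable_bound[OF assms])
    (use borel_measurable_integrable[OF assms] in \<open>auto simp: abs_mult mult_left_le\<close>)

text \<open>Differentiation under the integral sign with an explicit remainder: the Taylor error of
  the cosine integrates to \<open>h\<^sup>2\<close> times the absolute moment of order
  \<open>k + 2\<close>, so the difference quotient is off by at most
  \<open>\<bar>h\<bar> * M\<close>.\<close>

lemma cos_transform_deriv:
  assumes [measurable]: "g \<in> borel_measurable borel"
    and int: "\<And>j. j \<le> Suc (Suc k) \<Longrightarrow> j \<ge> k \<Longrightarrow> integrable lborel (\<lambda>t. g t * t ^ j)"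
  shows "(cos_transform g k has_real_derivative cos_transform g (Suc k) x) (at x)"
proof -
  define M where "M = (LINT t|lborel. \<bar>g t * t ^ Suc (Suc k)\<bar>)"
  have bnd: "\<bar>cos_transform g k (x + h) - cos_transform g k x - h * cos_transform g (Suc k) x\<bar> \<le> h\<^sup>2 * M" for h
  proof -
    have i1: "integrable lborel (\<lambda>t. g t * t ^ j * cos (t * y + c))" if "j \<in> {k, Suc k}" for y c j
      using int[of j] that by (intro integrable_times_cos) auto
    have i2: "integrable lborel (\<lambda>t. \<bar>g t * t ^ Suc (Suc k)\<bar>)"
      using int[of "Suc (Suc k)"] by (intro integrable_abs) auto
    have eq: "cos_transform g k (x + h) - cos_transform g k x - h * cos_transform g (Suc k) x
       = (LINT t|lborel. g t * t ^ k * cos (t * (x + h) + real k * pi / 2)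
            - g t * t ^ k * cos (t * x + real k * pi / 2)
            - h * (g t * t ^ Suc k * cos (t * x + real (Suc k) * pi / 2)))"
      unfolding cos_transform_def using i1[of k] i1[of "Suc k"]
      by (simp del: power_Suc of_nat_Suc)
    have "\<bar>cos_transform g k (x + h) - cos_transform g k x - h * cos_transform g (Suc k) x\<bar>
        \<le> (LINT t|lborel. h\<^sup>2 * \<bar>g t * t ^ Suc (Suc k)\<bar>)"
      unfolding eq
    proof (rule integral_abs_bound_integral)
      show "integrable lborel (\<lambda>t. g t * t ^ k * cos (t * (x + h) + real k * pi / 2)
            - g t * t ^ k * cos (t * x + real k * pi / 2)
            - h * (g t * t ^ Suc k * cos (t * x + real (Suc k) * pi / 2)))"
        using i1[of k] i1[of "Suc k"] by (simp del: power_Suc of_nat_Suc)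
      show "integrable lborel (\<lambda>t. h\<^sup>2 * \<bar>g t * t ^ Suc (Suc k)\<bar>)" using i2 by simp
      fix t :: real
      let ?a = "t * x + real k * pi / 2"
      \<comment> \<open>Raising \<open>k\<close> by one multiplies by \<open>t\<close> and advances
        the phase by \<open>pi / 2\<close>, which is exactly the linear Taylor term with increment
        \<open>t * h\<close>.\<close>
      have eq': "g t * t ^ k * cos (t * (x + h) + real k * pi / 2) - g t * t ^ k * cos ?a
            - h * (g t * t ^ Suc k * cos (t * x + real (Suc k) * pi / 2))
        = g t * t ^ k * (cos (?a + t * h) - cos ?a - (t * h) * cos (?a + pi / 2))"
        by (simp add: field_simps)
      have "\<bar>g t * t ^ k * (cos (?a + t * h) - cos ?a - (t * h) * cos (?a + pi / 2))\<bar> \<le> \<bar>g t * t ^ k\<bar> * (t * h)\<^sup>2"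
        unfolding abs_mult[of "g t * t ^ k"] by (intro mult_left_mono cos_taylor_2) auto
      also have "\<dots> = h\<^sup>2 * \<bar>g t * t ^ Suc (Suc k)\<bar>"
        by (simp add: abs_mult power_mult_distrib power2_eq_square)
      finally show "\<bar>g t * t ^ k * cos (t * (x + h) + real k * pi / 2) - g t * t ^ k * cos ?a
            - h * (g t * t ^ Suc k * cos (t * x + real (Suc k) * pi / 2))\<bar> \<le> h\<^sup>2 * \<bar>g t * t ^ Suc (Suc k)\<bar>"
        unfolding eq' .
    qed
    also have "\<dots> = h\<^sup>2 * M" unfolding M_def by (rule integral_mult_right_zero)
    finally show ?thesis .
  qed
  have "(\<lambda>h. (cos_transform g k (x + h) - cos_transform g k x) / h - cos_transform g (Suc k) x) \<midarrow>0\<rightarrow> 0"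
  proof (rule Lim_null_comparison)
    show "(\<lambda>h. \<bar>h\<bar> * M) \<midarrow>0\<rightarrow> 0" by (auto intro!: tendsto_eq_intros)
    show "\<forall>\<^sub>F h in at 0. norm ((cos_transform g k (x + h) - cos_transform g k x) / h - cos_transform g (Suc k) x) \<le> \<bar>h\<bar> * M"
      unfolding eventually_at_filter
    proof (rule always_eventually, intro allI impI)
      fix h :: real assume "h \<noteq> 0"
      have "(cos_transform g k (x + h) - cos_transform g k x) / h - cos_transform g (Suc k) x
         = (cos_transform g k (x + h) - cos_transform g k x - h * cos_transform g (Suc k) x) / h"
        using \<open>h \<noteq> 0\<close> by (simp add: field_simps)
      moreover have "\<bar>cos_transform g k (x + h) - cos_transform g k x - h * cos_transform g (Suc k) x\<bar> / \<bar>h\<bar>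
          \<le> h\<^sup>2 * M / \<bar>h\<bar>"
        using bnd[of h] by (intro divide_right_mono) auto
      moreover have "h\<^sup>2 * M / \<bar>h\<bar> = \<bar>h\<bar> * M"
        using \<open>h \<noteq> 0\<close> by (simp add: power2_eq_square abs_if)
      ultimately show "norm ((cos_transform g k (x + h) - cos_transform g k x) / h - cos_transform g (Suc k) x) \<le> \<bar>h\<bar> * M"
        by (simp only: real_norm_def abs_divide)
    qed
  qed
  then show ?thesis by (simp add: DERIV_def LIM_zero_cancel)
qed

text \<open>The last differentiation, from order \<open>k - 1\<close> to \<open>k\<close>, consumes
  the moment of order \<open>k + 1\<close>, hence the range of \<open>j\<close>.\<close>

lemma higher_deriv_cos_transform_shift:
  assumes "g \<in> borel_measurable borel"
    and "\<And>j. j \<le> Suc k \<Longrightarrow> integrable lborel (\<lambda>t. g t * t ^ j)"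
  shows "(deriv ^^ k) (\<lambda>x. c * cos_transform g 0 (x - b)) = (\<lambda>x. c * cos_transform g k (x - b))"
  using assms(2)
proof (induction k)
  case (Suc k)
  then have "(deriv ^^ Suc k) (\<lambda>x. c * cos_transform g 0 (x - b)) = deriv (\<lambda>x. c * cos_transform g k (x - b))"
    by simp
  also have "\<dots> = (\<lambda>x. c * cos_transform g (Suc k) (x - b))"
  proof (intro ext DERIV_imp_deriv DERIV_cmult)
    fix x
    have "(cos_transform g k has_real_derivative cos_transform g (Suc k) (x - b)) (at (x - b))"
      using Suc.prems by (intro cos_transform_deriv assms(1)) auto
    then show "((\<lambda>x. cos_transform g k (x - b)) has_real_derivative cos_transform g (Suc k) (x - b)) (at x)"
      using DERIV_shift[of "cos_transform g k" _ x "- b"] by simp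
  qed
  finally show ?case .
qed simp

section \<open>Powers of the cardinal sine\<close>

text \<open>Up to the phase \<open>iexp (t / 2)\<close>, the value \<open>card_sine (t / 2)\<close>
  is the characteristic function of the uniform distribution on the unit interval.\<close>

definition card_sine :: "real \<Rightarrow> real" where "card_sine x = sinc x"

lemma card_sine_nonzero: "x \<noteq> 0 \<Longrightarrow> card_sine x = sin x / x"
  by (simp add: card_sine_def)

lemma card_sine_0 [simp]: "card_sine 0 = 1"
  by (simp add: card_sine_def)

lemma card_sine_minus [simp]: "card_sine (- x) = card_sine x"
  by (simp add: card_sine_def)

lemma card_sine_abs: "card_sine \<bar>x\<bar> = card_sine x"
  by (simp add: abs_if)

lemma card_sine_measurable [measurable]: "card_sine \<in> borel_measurable borel"
  unfolding card_sine_def[abs_def] by measurable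

lemma abs_card_sine_le_1: "\<bar>card_sine x\<bar> \<le> 1"
  using abs_sin_x_le_abs_x[of x] by (cases "x = 0") (auto simp: card_sine_nonzero abs_divide divide_le_eq)

lemma abs_card_sine_le_inverse: "\<bar>x\<bar> * \<bar>card_sine x\<bar> \<le> 1"
  by (cases "x = 0") (auto simp: card_sine_nonzero abs_divide)

text \<open>Each sine factor absorbs one factor \<open>1 + \<bar>t\<bar>\<close>, so
  \<open>j + 2\<close> of them pay for \<open>t ^ j\<close> and for \<open>1 + t\<^sup>2\<close>.
  The constant \<open>4 ^ d\<close> grows with \<open>d\<close>; this gives integrability, not a
  rate.\<close>

lemma quad_decay_card_sine_power:
  assumes "j + 2 \<le> d"
  shows "quad_decay (\<lambda>t. card_sine (t / 2) ^ d * t ^ j)"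
proof (rule quad_decayI)
  fix t :: real
  let ?q = "1 + \<bar>t\<bar>"
  \<comment> \<open>The two bounds at \<open>t / 2\<close> give \<open>1 + 2\<close>.\<close>
  have "?q * \<bar>card_sine (t / 2)\<bar> \<le> 4"
    using abs_card_sine_le_1[of "t / 2"] abs_card_sine_le_inverse[of "t / 2"] by (simp add: algebra_simps)
  then have "(?q * \<bar>card_sine (t / 2)\<bar>) ^ d \<le> 4 ^ d" by (intro power_mono) auto
  then have 1: "?q ^ d * \<bar>card_sine (t / 2)\<bar> ^ d \<le> 4 ^ d" by (simp add: power_mult_distrib)
  have "1 + t\<^sup>2 \<le> ?q\<^sup>2" by (simp add: power2_eq_square algebra_simps flip: abs_mult)
  then have "(1 + t\<^sup>2) * \<bar>t\<bar> ^ j \<le> ?q\<^sup>2 * ?q ^ j"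
    by (intro mult_mono power_mono) auto
  also have "\<dots> = ?q ^ (j + 2)" by (simp only: power_add mult.commute)
  also have "\<dots> \<le> ?q ^ d" using assms by (intro power_increasing) auto
  finally have "(1 + t\<^sup>2) * \<bar>t\<bar> ^ j * \<bar>card_sine (t / 2)\<bar> ^ d \<le> ?q ^ d * \<bar>card_sine (t / 2)\<bar> ^ d"
    by (intro mult_right_mono) auto
  with 1 have "(1 + t\<^sup>2) * \<bar>t\<bar> ^ j * \<bar>card_sine (t / 2)\<bar> ^ d \<le> 4 ^ d" by linarith
  then show "\<bar>card_sine (t / 2) ^ d * t ^ j\<bar> \<le> 4 ^ d / (1 + t\<^sup>2)"
    by (simp add: pos_le_divide_eq one_plus_square_pos abs_mult power_abs ac_simps)
qed

section \<open>Comparison of sine powers with the Gaussian\<close>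

text \<open>Both functions expand as \<open>1 - y\<close> plus a term of order
  \<open>y\<^sup>2\<close>, where \<open>y = a\<^sup>2 / 6\<close>. The sine remainder
  \<open>a ^ 4 / 120\<close> equals \<open>3 / 10 * y\<^sup>2\<close>, and the exponential
  contributes \<open>y\<^sup>2 / 2\<close>; together
  \<open>4 / 5 * y\<^sup>2 = a ^ 4 / 45\<close>.\<close>

lemma card_sine_gaussian_bounds:
  assumes "a\<^sup>2 \<le> 4"
  shows "0 \<le> card_sine a" "card_sine a \<le> exp (- a\<^sup>2 / 6)" "exp (- a\<^sup>2 / 6) - card_sine a \<le> a ^ 4 / 45"
proof -
  have sb: "\<bar>card_sine a - (1 - a\<^sup>2 / 6)\<bar> \<le> a ^ 4 / 120"
  proof (cases "a = 0")
    case False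
    have "(\<Sum>m<5. sin_coeff m * a ^ m) = a - a ^ 3 / 6"
      by (simp add: lessThan_nat_numeral lessThan_Suc sin_coeff_def fact_numeral)
    moreover have "inverse (fact 5) * \<bar>a\<bar> ^ 5 = \<bar>a\<bar> ^ 5 / 120"
      by (simp add: fact_numeral)
    ultimately have "\<bar>sin a - (a - a ^ 3 / 6)\<bar> \<le> \<bar>a\<bar> ^ 5 / 120"
      using Maclaurin_sin_bound[of a 5] by (simp only:)
    then have "\<bar>(sin a - (a - a ^ 3 / 6)) / a\<bar> \<le> \<bar>a\<bar> ^ 5 / 120 / \<bar>a\<bar>"
      unfolding abs_divide by (intro divide_right_mono) auto
    also have "\<bar>a\<bar> ^ 5 / 120 / \<bar>a\<bar> = a ^ 4 / 120"
      using False power_even_abs[of 4 a] by (simp add: eval_nat_numeral)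
    also have "(sin a - (a - a ^ 3 / 6)) / a = card_sine a - (1 - a\<^sup>2 / 6)"
      using False by (simp add: card_sine_nonzero field_simps power2_eq_square power3_eq_cube)
    finally show ?thesis .
  qed simp
  define y where "y = a\<^sup>2 / 6"
  have a4: "a ^ 4 = 36 * y\<^sup>2" by (simp add: y_def power_divide flip: power_mult)
  have y: "0 \<le> y" "y \<le> 2 / 3" using assms by (auto simp: y_def)
  obtain t where "exp (- y) = (\<Sum>m<3. (- y) ^ m / fact m) + exp t / fact 3 * (- y) ^ 3"
    using Maclaurin_exp_le[of "- y" 3] by blast
  moreover have "(\<Sum>m<3. (- y) ^ m / fact m) = 1 - y + y\<^sup>2 / 2"
    by (simp add: eval_nat_numeral)
  moreover have "exp t / fact 3 * (- y) ^ 3 \<le> 0"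
    using y by (intro mult_nonneg_nonpos) (auto simp: power3_eq_cube)
  ultimately have up: "exp (- y) \<le> 1 - y + y\<^sup>2 / 2"
    by linarith
  obtain t where "exp (- y) = (\<Sum>m<4. (- y) ^ m / fact m) + exp t / fact 4 * (- y) ^ 4"
    using Maclaurin_exp_le[of "- y" 4] by blast
  moreover have "(\<Sum>m<4. (- y) ^ m / fact m) = 1 - y + y\<^sup>2 / 2 - y ^ 3 / 6"
    by (simp add: eval_nat_numeral)
  moreover have "exp t / fact 4 * (- y) ^ 4 \<ge> 0" by simp
  ultimately have lo: "1 - y + y\<^sup>2 / 2 - y ^ 3 / 6 \<le> exp (- y)"
    by linarith
  \<comment> \<open>With \<open>y \<le> 2 / 3\<close> the lower bound
    \<open>1 - y - 3 / 10 * y\<^sup>2\<close> stays positive, and the cubic term of the exponential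
    costs at most \<open>y\<^sup>2 / 9\<close>, less than the gap between \<open>3 / 10\<close> and
    \<open>1 / 2\<close>.\<close>
  have ylin: "y\<^sup>2 \<le> 2 / 3 * y" unfolding power2_eq_square using y by (intro mult_right_mono)
  have y3: "y ^ 3 \<le> 2 / 3 * y\<^sup>2" unfolding power2_eq_square power3_eq_cube mult.assoc
    using y by (intro mult_right_mono) auto
  have sb': "\<bar>card_sine a - (1 - y)\<bar> \<le> 3 / 10 * y\<^sup>2" using sb a4 by (simp add: y_def)
  show "0 \<le> card_sine a" using sb' ylin y by linarith
  have "card_sine a \<le> exp (- y)" using sb' y3 lo zero_le_power2[of y] by linarith
  then show "card_sine a \<le> exp (- a\<^sup>2 / 6)" by (simp add: y_def)
  have "exp (- y) - card_sine a \<le> a ^ 4 / 45" using sb' up unfolding a4 by linarith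
  then show "exp (- a\<^sup>2 / 6) - card_sine a \<le> a ^ 4 / 45" by (simp add: y_def)
qed

text \<open>The difference of powers is \<open>E - s\<close> times a sum of \<open>n + 1\<close>
  products of degree \<open>n\<close>, each at most \<open>E ^ n\<close>.\<close>

lemma power_diff_le:
  fixes s E :: real
  assumes "0 \<le> s" "s \<le> E"
  shows "E ^ Suc n - s ^ Suc n \<le> real (Suc n) * E ^ n * (E - s)"
proof (induction n)
  case (Suc n)
  have "E ^ Suc (Suc n) - s ^ Suc (Suc n) = E * (E ^ Suc n - s ^ Suc n) + s ^ Suc n * (E - s)"
    by (simp add: algebra_simps)
  also have "\<dots> \<le> E * (real (Suc n) * E ^ n * (E - s)) + E ^ Suc n * (E - s)"
    using assms Suc by (intro add_mono mult_left_mono mult_right_mono power_mono) auto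
  also have "\<dots> = real (Suc (Suc n)) * E ^ Suc n * (E - s)" by (simp add: algebra_simps)
  finally show ?case .
qed simp

lemma power_over_exp_bounded: obtains B where "\<And>d. real d ^ m / 2 ^ d \<le> B"
proof -
  have "(\<lambda>d. real d ^ m / 2 ^ d) \<longlonglongrightarrow> 0" by real_asymp
  then have "Bseq (\<lambda>d. real d ^ m / 2 ^ d)" by (intro convergent_imp_Bseq) (auto simp: convergent_def)
  then obtain B where "\<And>d. norm (real d ^ m / 2 ^ d) \<le> B" unfolding Bseq_def by blast
  then show ?thesis using that abs_ge_self unfolding real_norm_def by (metis order_trans)
qed

text \<open>The central region. The power \<open>d\<close> costs a factor \<open>d\<close>, while
  the bases differ by \<open>a ^ 4 / 45 = u ^ 4 / (5 * d\<^sup>2)\<close>, so one factor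
  \<open>1 / d\<close> survives.\<close>

lemma card_sine_power_gaussian_diff:
  assumes "d \<ge> 2" "u\<^sup>2 * 3 / real d \<le> 4"
  shows "\<bar>card_sine (u * sqrt (3 / real d)) ^ d - exp (- u\<^sup>2 / 2)\<bar> \<le> u ^ 4 * exp (- (1/4 * u\<^sup>2)) / (5 * real d)"
proof -
  define a where "a = u * sqrt (3 / real d)"
  have a2: "a\<^sup>2 = u\<^sup>2 * 3 / real d" using assms by (simp add: a_def power_mult_distrib)
  have a4: "a ^ 4 = 9 * u ^ 4 / (real d)\<^sup>2"
    using arg_cong[OF a2, of "\<lambda>x. x\<^sup>2"] by (simp add: power_divide power_mult_distrib flip: power_mult)
  have "a\<^sup>2 \<le> 4" using assms a2 by simp
  note b = card_sine_gaussian_bounds[OF this]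
  define E where "E = exp (- a\<^sup>2 / 6)"
  obtain n where n: "d = Suc n" "n \<ge> 1" using assms(1) by (cases d) auto
  have Ed: "E ^ d = exp (- u\<^sup>2 / 2)"
    using assms by (simp add: E_def a2 flip: exp_of_nat_mult)
  have "E ^ n = exp (- (real n / real d * u\<^sup>2 / 2))"
    using assms by (simp add: E_def a2 field_simps flip: exp_of_nat_mult)
  also have "\<dots> \<le> exp (- (1/4 * u\<^sup>2))"
  proof -
    \<comment> \<open>Only \<open>n = d - 1\<close> Gaussian factors remain;
      \<open>d \<ge> 2\<close> makes \<open>n / d\<close> at least \<open>1/2\<close>, which leaves
      the weaker Gaussian \<open>exp (- (1/4 * u\<^sup>2))\<close>.\<close>
    have "1/2 * u\<^sup>2 \<le> real n / real d * u\<^sup>2" using n by (intro mult_right_mono) (auto simp: field_simps)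
    then have "- (real n / real d * u\<^sup>2 / 2) \<le> - (1/4 * u\<^sup>2)" by argo
    then show ?thesis by (simp only: exp_le_cancel_iff)
  qed
  finally have En: "E ^ n \<le> exp (- (1/4 * u\<^sup>2))" .
  have "E ^ d - card_sine a ^ d \<le> real d * E ^ n * (E - card_sine a)"
    unfolding n(1) by (rule power_diff_le) (use b in \<open>auto simp: E_def\<close>)
  also have "\<dots> \<le> real d * exp (- (1/4 * u\<^sup>2)) * (a ^ 4 / 45)"
    using b En by (intro mult_mono) (auto simp: E_def)
  also have "\<dots> = u ^ 4 * exp (- (1/4 * u\<^sup>2)) / (5 * real d)"
    using assms(1) by (simp add: a4 field_simps power2_eq_square)
  finally have "E ^ d - card_sine a ^ d \<le> u ^ 4 * exp (- (1/4 * u\<^sup>2)) / (5 * real d)" .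
  moreover have "card_sine a ^ d \<le> E ^ d" using b by (intro power_mono) (auto simp: E_def)
  ultimately show ?thesis unfolding Ed a_def by simp
qed

text \<open>Each sine factor is at most \<open>1 / a\<close> with \<open>a > 2\<close>. Writing
  \<open>\<bar>u\<bar> = r * a\<close>, \<open>k + 2\<close> of these factors cancel the growth of
  \<open>\<bar>u\<bar> ^ (k + 2)\<close> up to \<open>r ^ (k + 2)\<close>, and the remaining
  \<open>d - k - 2\<close> give the exponential gain.\<close>

lemma card_sine_power_tail:
  assumes "d \<ge> k + 3" "u\<^sup>2 * 3 / real d > 4"
  shows "\<bar>u\<bar> ^ k * \<bar>card_sine (u * sqrt (3 / real d)) ^ d\<bar> \<le> 2 ^ (k + 3) * (real d ^ (k + 2) / 2 ^ d) / (1 + u\<^sup>2)"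
proof -
  define a where "a = \<bar>u\<bar> * sqrt (3 / real d)"
  define r where "r = sqrt (real d / 3)"
  have d: "real d \<ge> 3" using assms(1) by simp
  have r: "1 \<le> r" "r \<le> real d"
    using d by (auto simp: r_def intro!: real_le_lsqrt mult_imp_div_pos_le) (simp add: field_simps power2_eq_square)
  have ua: "\<bar>u\<bar> = r * a" using d by (simp add: r_def a_def real_sqrt_divide)
  have "a\<^sup>2 = u\<^sup>2 * 3 / real d" using d by (simp add: a_def power_mult_distrib)
  then have "2\<^sup>2 < a\<^sup>2" using assms by simp
  moreover have "0 \<le> a" by (simp add: a_def)
  ultimately have a: "2 < a" by (rule power2_less_imp_less)
  \<comment> \<open>Away from 0 the factor \<open>1 / u\<^sup>2\<close> can be replaced by
    \<open>2 / (1 + u\<^sup>2)\<close> at the end.\<close>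
  have u1: "1 \<le> u\<^sup>2" using a r ua mult_mono[of 1 r 1 a] abs_le_square_iff[of 1 u] by simp
  have sa: "\<bar>card_sine (u * sqrt (3 / real d))\<bar> \<le> 1 / a"
  proof -
    have "card_sine (u * sqrt (3 / real d)) = card_sine a"
      using card_sine_abs[of "u * sqrt (3 / real d)"] by (simp add: a_def abs_mult)
    then show ?thesis using abs_card_sine_le_inverse[of a] a by (simp add: field_simps)
  qed
  have "\<bar>u\<bar> ^ k * \<bar>card_sine (u * sqrt (3 / real d)) ^ d\<bar> \<le> \<bar>u\<bar> ^ k * (1 / a) ^ d"
    unfolding power_abs using sa by (intro mult_left_mono power_mono) auto
  also have "\<dots> = \<bar>u\<bar> ^ (k + 2) / u\<^sup>2 / (a ^ (k + 2) * a ^ (d - k - 2))"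
  proof -
    have "a ^ (k + 2) * a ^ (d - k - 2) = a ^ d"
      using assms(1) unfolding power_add[symmetric] by (intro arg_cong[where f = "(^) a"]) auto
    moreover have "\<bar>u\<bar> ^ (k + 2) / u\<^sup>2 = \<bar>u\<bar> ^ k" using u1 by (subst power_add) (subst power2_abs, auto)
    ultimately show ?thesis by (simp add: power_divide)
  qed
  also have "\<dots> = r ^ (k + 2) / u\<^sup>2 / a ^ (d - k - 2)"
    unfolding ua power_mult_distrib using a by simp
  also have "\<dots> \<le> real d ^ (k + 2) / u\<^sup>2 / 2 ^ (d - k - 2)"
    using r a u1 by (intro frac_le divide_right_mono power_mono) auto
  also have "2 ^ (d - k - 2) = (2::real) ^ d / 2 ^ (k + 2)"
    using assms(1) power_diff[of "2::real" "k + 2" d] by simp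
  also have "real d ^ (k + 2) / u\<^sup>2 / (2 ^ d / 2 ^ (k + 2)) = 2 ^ (k + 2) * (real d ^ (k + 2) / 2 ^ d) * (1 / u\<^sup>2)"
    by (simp add: ac_simps)
  also have "\<dots> \<le> 2 ^ (k + 2) * (real d ^ (k + 2) / 2 ^ d) * (2 / (1 + u\<^sup>2))"
    using u1 by (intro mult_left_mono) (auto simp: divide_simps)
  also have "\<dots> = 2 ^ (k + 3) * (real d ^ (k + 2) / 2 ^ d) / (1 + u\<^sup>2)" by (simp add: power_add)
  finally show ?thesis .
qed

text \<open>With \<open>a = u * sqrt (3 / d)\<close> the Gaussian is \<open>exp (- a\<^sup>2 / 6) ^ d\<close>. For \<open>\<bar>a\<bar> \<le> 2\<close> the bases differ by
  \<open>O(a ^ 4) = O(u ^ 4 / d\<^sup>2)\<close>; for \<open>\<bar>a\<bar> > 2\<close> the sine power is exponentially small in \<open>d\<close> and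
  the Gaussian gains a factor \<open>u\<^sup>2 / d \<ge> 1\<close>.\<close>

lemma card_sine_power_gaussian_rate:
  obtains C where "0 \<le> C" "\<And>d u. d \<ge> k + 3 \<Longrightarrow>
    \<bar>u\<bar> ^ k * \<bar>card_sine (u * sqrt (3 / real d)) ^ d - exp (- u\<^sup>2 / 2)\<bar> \<le> C / real d / (1 + u\<^sup>2)"
proof -
  obtain C1 where C1: "\<And>u::real. \<bar>u ^ (k + 4) * exp (- (1/4 * u\<^sup>2))\<bar> \<le> C1 / (1 + u\<^sup>2)"
    using quad_decay_gaussian[of "1/4" "k + 4"] unfolding quad_decay_def by auto
  obtain C2 where C2: "\<And>u::real. \<bar>u ^ (k + 2) * exp (- (1/2 * u\<^sup>2))\<bar> \<le> C2 / (1 + u\<^sup>2)"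
    using quad_decay_gaussian[of "1/2" "k + 2"] unfolding quad_decay_def by auto
  \<comment> \<open>The tail bound carries \<open>d ^ (k + 2)\<close>; bounding one power more
    leaves the factor \<open>1 / d\<close>.\<close>
  obtain B where B: "\<And>d. real d ^ (k + 3) / 2 ^ d \<le> B" using power_over_exp_bounded[of "k + 3"] by blast
  have nn: "0 \<le> C1" "0 \<le> C2" "0 \<le> B" using C1[of 0] C2[of 0] B[of 0] by (auto simp: power_0_left split: if_splits)
  define C where "C = C1 + C2 + 2 ^ (k + 3) * B"
  have main: "\<bar>u\<bar> ^ k * \<bar>card_sine (u * sqrt (3 / real d)) ^ d - exp (- u\<^sup>2 / 2)\<bar> \<le> C / real d / (1 + u\<^sup>2)"
    if d: "d \<ge> k + 3" for d u
  proof (cases "u\<^sup>2 * 3 / real d \<le> 4")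
    case True
    have "\<bar>u\<bar> ^ k * \<bar>card_sine (u * sqrt (3 / real d)) ^ d - exp (- u\<^sup>2 / 2)\<bar>
        \<le> \<bar>u\<bar> ^ k * (u ^ 4 * exp (- (1/4 * u\<^sup>2)) / (5 * real d))"
      using card_sine_power_gaussian_diff[OF _ True] d by (intro mult_left_mono) auto
    also have "\<dots> = \<bar>u ^ (k + 4) * exp (- (1/4 * u\<^sup>2))\<bar> / (5 * real d)"
      by (simp add: power_add abs_mult power_abs)
    also have "\<dots> \<le> C1 / (1 + u\<^sup>2) / (1 * real d)"
      using C1[of u] d nn one_plus_square_pos[of u] by (intro frac_le mult_right_mono) auto
    also have "\<dots> \<le> C / real d / (1 + u\<^sup>2)"
      using nn one_plus_square_pos[of u] by (simp add: C_def divide_right_mono mult.commute)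
    finally show ?thesis .
  next
    case False
    then have u: "u\<^sup>2 * 3 / real d > 4" by simp
    have "\<bar>u\<bar> ^ k * \<bar>card_sine (u * sqrt (3 / real d)) ^ d - exp (- u\<^sup>2 / 2)\<bar>
      \<le> \<bar>u\<bar> ^ k * (\<bar>card_sine (u * sqrt (3 / real d)) ^ d\<bar> + \<bar>exp (- u\<^sup>2 / 2)\<bar>)"
      by (intro mult_left_mono abs_triangle_ineq4) auto
    also have "\<dots> = \<bar>u\<bar> ^ k * \<bar>card_sine (u * sqrt (3 / real d)) ^ d\<bar> + \<bar>u\<bar> ^ k * exp (- (1/2 * u\<^sup>2))"
      by (simp add: algebra_simps)
    also have "\<dots> \<le> 2 ^ (k + 3) * B / real d / (1 + u\<^sup>2) + C2 / real d / (1 + u\<^sup>2)"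
    proof (rule add_mono)
      have "real d ^ (k + 2) / 2 ^ d \<le> B / real d"
        using B[of d] d by (simp add: field_simps power_add eval_nat_numeral)
      then have "2 ^ (k + 3) * (real d ^ (k + 2) / 2 ^ d) / (1 + u\<^sup>2) \<le> 2 ^ (k + 3) * (B / real d) / (1 + u\<^sup>2)"
        using one_plus_square_pos[of u] by (intro divide_right_mono mult_left_mono) auto
      then show "\<bar>u\<bar> ^ k * \<bar>card_sine (u * sqrt (3 / real d)) ^ d\<bar> \<le> 2 ^ (k + 3) * B / real d / (1 + u\<^sup>2)"
        using card_sine_power_tail[OF d u] by simp
      have "1 \<le> u\<^sup>2 / real d" using u d by (simp add: field_simps)
      then have "\<bar>u\<bar> ^ k * exp (- (1/2 * u\<^sup>2)) * 1 \<le> \<bar>u\<bar> ^ k * exp (- (1/2 * u\<^sup>2)) * (u\<^sup>2 / real d)"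
        by (intro mult_left_mono) auto
      also have "\<dots> = \<bar>u ^ (k + 2) * exp (- (1/2 * u\<^sup>2))\<bar> / real d"
        by (subst power_add) (simp add: abs_mult power_abs)
      also have "\<dots> \<le> C2 / (1 + u\<^sup>2) / real d" by (intro divide_right_mono C2) auto
      finally show "\<bar>u\<bar> ^ k * exp (- (1/2 * u\<^sup>2)) \<le> C2 / real d / (1 + u\<^sup>2)" by (simp add: mult.commute)
    qed
    also have "\<dots> = (2 ^ (k + 3) * B + C2) / real d / (1 + u\<^sup>2)" by (simp add: add_divide_distrib)
    also have "\<dots> \<le> C / real d / (1 + u\<^sup>2)"
      using nn one_plus_square_pos[of u] by (intro divide_right_mono) (auto simp: C_def)
    finally show ?thesis .
  qed
  show ?thesis by (rule that[of C]) (use main nn in \<open>auto simp: C_def\<close>)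
qed

section \<open>Fourier inversion for B-splines\<close>

text \<open>The closed interval suits the fundamental theorem of calculus used for the
  characteristic function; it differs from the half-open interval of the spline by a null
  set.\<close>

lemma real_distribution_unit: "real_distribution (density lborel (\<lambda>x. ennreal (indicator {0..1::real} x)))"
proof -
  have "(\<integral>\<^sup>+x. ennreal (indicator {0..1::real} x) \<partial>lborel) = 1"
    by (simp add: ennreal_indicator)
  then have "prob_space (density lborel (\<lambda>x. ennreal (indicator {0..1::real} x)))"
    by (intro prob_spaceI) (simp add: emeasure_density)
  then show ?thesis by (intro real_distribution.intro) (auto simp: real_distribution_axioms_def)
qed

lemma iexp_minus_1: "iexp t - 1 = iexp (t / 2) * (2 * \<i> * sin (t / 2))" for t :: real
  using sin_double[of "t / 2"] cos_double_sin[of "t / 2"]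
  by (simp add: complex_eq_iff Re_exp Im_exp power2_eq_square)

lemma char_unit:
  assumes "t \<noteq> 0"
  shows "char (density lborel (\<lambda>x. ennreal (indicator {0..1::real} x))) t = (iexp t - 1) / (\<i> * t)"
proof -
  have "char (density lborel (\<lambda>x. ennreal (indicator {0..1::real} x))) t = (CLINT x|lborel. indicator {0..1} x *\<^sub>R iexp (t * x))"
    unfolding char_def by (intro integral_density) auto
  also have "\<dots> = iexp (t * 1) / (\<i> * t) - iexp (t * 0) / (\<i> * t)"
  proof (rule integral_FTC_atLeastAtMost)
    fix x :: real
    show "((\<lambda>x. iexp (t * x) / (\<i> * t)) has_vector_derivative iexp (t * x)) (at x within {0..1})"
      using assms by (auto intro!: derivative_eq_intros has_vector_derivative_real_field simp: ac_simps)
  qed (auto intro!: continuous_intros)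
  finally show ?thesis by (simp add: diff_divide_distrib)
qed

text \<open>A window of length 1 contributes the factor \<open>(iexp t - 1) / (\<i> * t)\<close> a
  second time. Extracting \<open>iexp (t / 2)\<close> from each of the two factors leaves the
  squared cardinal sine and shifts the centre from \<open>x\<close> to \<open>x - 1\<close>.\<close>

lemma levy_integrand_unit:
  fixes t x :: real
  assumes "t \<noteq> 0"
  shows "(iexp (- (t * (x - 1))) - iexp (- (t * x))) / (\<i> * t) *
      char (density lborel (\<lambda>x. ennreal (indicator {0..1::real} x))) t
    = of_real ((card_sine (t / 2))\<^sup>2) * iexp (- (t * (x - 1)))"
proof -
  have "iexp (- (t * (x - 1))) - iexp (- (t * x)) = iexp (- (t * x)) * (iexp t - 1)"
    by (simp add: algebra_simps flip: exp_add)
  then have "(iexp (- (t * (x - 1))) - iexp (- (t * x))) / (\<i> * t) * ((iexp t - 1) / (\<i> * t))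
      = iexp (- (t * x)) * (iexp t - 1)\<^sup>2 / (\<i> * t)\<^sup>2"
    by (simp add: power2_eq_square)
  also have "(iexp t - 1)\<^sup>2 = iexp t * (2 * \<i> * sin (t / 2))\<^sup>2"
    unfolding iexp_minus_1 power_mult_distrib by (simp add: power2_eq_square flip: exp_add)
  also have "iexp (- (t * x)) * (iexp t * (2 * \<i> * sin (t / 2))\<^sup>2) / (\<i> * t)\<^sup>2
     = (iexp (- (t * x)) * iexp t) * of_real ((card_sine (t / 2))\<^sup>2)"
    using assms by (simp add: card_sine_nonzero power_mult_distrib field_simps)
  also have "iexp (- (t * x)) * iexp t = iexp (- (t * (x - 1)))"
    by (simp add: algebra_simps flip: exp_add)
  finally show ?thesis unfolding char_unit[OF assms] by simp
qed

text \<open>The shift to \<open>Suc i\<close> keeps every approximating interval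
  nondegenerate.\<close>

lemma einterval_UNIV_approx: "einterval (-\<infinity>) \<infinity> = (\<Union>i. {- real (Suc i)..real (Suc i)})"
proof -
  have "\<exists>i. x \<in> {- real (Suc i)..real (Suc i)}" for x
  proof -
    obtain n where "\<bar>x\<bar> \<le> real n" using real_arch_simple by blast
    then show ?thesis by (intro exI[of _ n]) auto
  qed
  then show ?thesis by (auto simp: einterval_eq_UNIV)
qed

text \<open>The condition \<open>x - y \<in> {0..<1}\<close> means
  \<open>y \<in> {x - 1<..x}\<close>, so the convolution of two boxes is a window probability; the
  two integrands can differ only at \<open>y = 1\<close>.\<close>

lemma measure_unit_window:
  "measure (density lborel (\<lambda>x. ennreal (indicator {0..1::real} x))) {x - 1<..x} = bspline 2 x"
proof -
  have "emeasure (density lborel (\<lambda>x. ennreal (indicator {0..1::real} x))) {x - 1<..x} = emeasure lborel ({0..1} \<inter> {x - 1<..x})"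
    by (subst emeasure_density) (auto simp: ennreal_indicator simp flip: indicator_inter_arith)
  then have "measure (density lborel (\<lambda>x. ennreal (indicator {0..1::real} x))) {x - 1<..x} = measure lborel ({0..1} \<inter> {x - 1<..x})"
    by (simp add: measure_def)
  also have "\<dots> = (LINT y|lborel. indicator ({0..1} \<inter> {x - 1<..x}) y)" by simp
  also have "\<dots> = (LINT y|lborel. indicator {0..<1} (x - y) * indicator {0..<1} y)"
    using AE_lborel_singleton[of 1]
    by (intro integral_cong_AE) (auto simp: indicator_def split: if_splits)
  also have "\<dots> = bspline 2 x" by (simp add: numeral_2_eq_2 fun_convolution_def)
  finally show ?thesis .
qed

lemma integrable_card_sine_power:
  "j + 2 \<le> d \<Longrightarrow> integrable lborel (\<lambda>t. card_sine (t / 2) ^ d * t ^ j)"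
  by (rule quad_decay_integrable[OF quad_decay_card_sine_power]) auto

text \<open>Levy inversion for the uniform distribution on \<open>[0, 1]\<close> and the window \<open>(x - 1, x]\<close>.
  At order 1 the Fourier integral would not converge absolutely.\<close>

lemma bspline_2_fourier:
  "bspline 2 x = 1 / (2 * pi) * (LINT t|lborel. card_sine (t / 2) ^ 2 * cos (t * (x - 1)))"
proof -
  let ?M = "density lborel (\<lambda>x. ennreal (indicator {0..1::real} x))"
  interpret real_distribution ?M by (rule real_distribution_unit)
  let ?G = "\<lambda>t::real. complex_of_real ((card_sine (t / 2))\<^sup>2) * iexp (- (t * (x - 1)))"
  \<comment> \<open>Levy inversion requires that the endpoints of the window are not atoms.\<close>
  have null: "measure ?M {y} = 0" for y
    by (simp add: measure_def emeasure_density nn_integral_null_set null_sets_def)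
  have L: "(\<lambda>T. 1 / (2 * pi) * (CLBINT t=-real (Suc T)..real (Suc T). (iexp (-(t * (x - 1))) - iexp (-(t * x))) / (\<i> * t) * char ?M t))
    \<longlonglongrightarrow> complex_of_real (measure ?M {x - 1<..x})"
    using LIMSEQ_Suc[OF Levy_Inversion[of "x - 1" x]] null by simp
  \<comment> \<open>The closed form of the integrand holds off \<open>t = 0\<close>, a null
    set.\<close>
  have eq: "(CLBINT t=-real (Suc T)..real (Suc T). (iexp (-(t * (x - 1))) - iexp (-(t * x))) / (\<i> * t) * char ?M t)
     = (CLBINT t=-real (Suc T)..real (Suc T). ?G t)" for T
    by (rule interval_integral_discrete_difference[of "{0}"]; (rule levy_integrand_unit)?) auto
  have iG: "integrable lborel ?G"
  proof (rule Bochner_Integration.integrable_bound)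
    show "integrable lborel (\<lambda>t. card_sine (t / 2) ^ 2 * t ^ 0)" by (rule integrable_card_sine_power) simp
  qed (auto simp: norm_mult norm_power)
  \<comment> \<open>Unlike the inversion formula in general, the integrand here is absolutely
    integrable, so the symmetric limit is the integral over the whole line.\<close>
  have "(\<lambda>T. CLBINT t=-real (Suc T)..real (Suc T). ?G t) \<longlonglongrightarrow> (CLBINT t=-\<infinity>..\<infinity>. ?G t)"
  proof (rule interval_integral_Icc_approx_integrable)
    show "set_integrable lborel (einterval (-\<infinity>) \<infinity>) ?G" using iG by (simp add: set_integrable_def)
    show lim: "(\<lambda>x. ereal (real (Suc x))) \<longlonglongrightarrow> \<infinity>"
    proof -
      have "filterlim (\<lambda>x. real (Suc x)) at_top sequentially" by real_asymp
      then show ?thesis by (simp add: tendsto_PInfty_eq_at_top)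
    qed
    show "(\<lambda>x. ereal (- real (Suc x))) \<longlonglongrightarrow> -\<infinity>"
      using tendsto_uminus_ereal[OF lim] by simp
  qed (auto simp: einterval_UNIV_approx incseq_def decseq_def simp del: einterval_eq)
  also have "(CLBINT t=-\<infinity>..\<infinity>. ?G t) = (CLINT t|lborel. ?G t)"
    by (simp add: interval_lebesgue_integral_def set_lebesgue_integral_def)
  finally have "(\<lambda>T. 1 / (2 * pi) * (CLBINT t=-real (Suc T)..real (Suc T). ?G t))
     \<longlonglongrightarrow> 1 / (2 * pi) * (CLINT t|lborel. ?G t)" by (intro tendsto_intros)
  then have "complex_of_real (bspline 2 x) = 1 / (2 * pi) * (CLINT t|lborel. ?G t)"
    using L unfolding eq measure_unit_window by (rule LIMSEQ_unique[rotated])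
  then have "bspline 2 x = Re (1 / (2 * pi) * (CLINT t|lborel. ?G t))" by (metis Re_complex_of_real)
  also have "\<dots> = 1 / (2 * pi) * Re (CLINT t|lborel. ?G t)"
    using Re_divide_of_real[of "CLINT t|lborel. ?G t" "2 * pi"] by simp
  also have "Re (CLINT t|lborel. ?G t) = (LINT t|lborel. Re (?G t))"
    by (rule integral_Re[OF iG, symmetric])
  also have "\<dots> = (LINT t|lborel. card_sine (t / 2) ^ 2 * cos (t * (x - 1)))"
    by (intro Bochner_Integration.integral_cong refl) (simp add: Re_exp flip: of_real_power)
  finally show ?thesis .
qed

section \<open>From order 2 to all orders by convolution\<close>

text \<open>Cosines are reproduced by convolution with the unit box: the amplitude gains a factor
  \<open>card_sine (t / 2)\<close> and the centre moves by \<open>1 / 2\<close>, the midpoint of the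
  box.\<close>

lemma integral_cos_window:
  "(LINT y|lborel. indicator {0..<1} (x - y) * cos (t * (y - c))) = card_sine (t / 2) * cos (t * (x - 1 / 2 - c))"
proof -
  have "(LINT y|lborel. indicator {0..<1} (x - y) * cos (t * (y - c))) = (LINT y|lborel. indicator {x - 1..x} y *\<^sub>R cos (t * (y - c)))"
    using AE_lborel_singleton[of "x - 1"]
    by (intro integral_cong_AE) (auto simp: indicator_def split: if_splits)
  also have "\<dots> = card_sine (t / 2) * cos (t * (x - 1 / 2 - c))"
  proof (cases "t = 0")
    case False
    have "(LINT y|lborel. indicator {x - 1..x} y *\<^sub>R cos (t * (y - c))) = sin (t * (x - c)) / t - sin (t * (x - 1 - c)) / t"
    proof (rule integral_FTC_atLeastAtMost)
      fix y :: real
      show "((\<lambda>y. sin (t * (y - c)) / t) has_vector_derivative cos (t * (y - c))) (at y within {x - 1..x})"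
        unfolding has_real_derivative_iff_has_vector_derivative[symmetric]
        using False by (auto intro!: derivative_eq_intros)
    qed (auto intro!: continuous_intros)
    also have "\<dots> = (sin (t * (x - c)) - sin (t * (x - 1 - c))) / t" by (simp add: diff_divide_distrib)
    also have "sin (t * (x - c)) - sin (t * (x - 1 - c)) = 2 * sin (t / 2) * cos (t * (x - 1 / 2 - c))"
    proof -
      have 1: "t * (x - c) = t * (x - 1 / 2 - c) + t / 2" "t * (x - 1 - c) = t * (x - 1 / 2 - c) - t / 2"
        by (simp_all add: algebra_simps)
      show ?thesis unfolding 1 sin_add sin_diff by simp
    qed
    finally show ?thesis using False by (simp add: card_sine_nonzero)
  qed simp
  finally show ?thesis .
qed

text \<open>Provides the joint integrability for Fubini: \<open>S\<close> has finite measure,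
  \<open>f\<close> is integrable, and the oscillating factor \<open>h\<close> is bounded.\<close>

lemma integrable_pair_window:
  fixes f :: "real \<Rightarrow> real"
  assumes f: "integrable lborel f"
    and [measurable]: "S \<in> sets borel" "case_prod h \<in> borel_measurable (borel \<Otimes>\<^sub>M borel)"
    and S: "emeasure lborel S < \<infinity>" and h: "\<And>t y. \<bar>h t y\<bar> \<le> (1::real)"
  shows "integrable (lborel \<Otimes>\<^sub>M lborel) (\<lambda>(t, y). indicator S y * f t * h t y)"
proof -
  have [measurable]: "f \<in> borel_measurable borel" using f by auto
  have m: "(\<lambda>(t, y). indicator S y * f t) \<in> borel_measurable (lborel \<Otimes>\<^sub>M lborel)" by measurable
  have "integrable (lborel \<Otimes>\<^sub>M lborel) (\<lambda>(t, y). indicator S y * f t)"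
  proof (rule lborel_pair.Fubini_integrable[OF m])
    have "integrable lborel (\<lambda>t. measure lborel S * \<bar>f t\<bar>)" using f by auto
    moreover have "(LINT y|lborel. norm (case (t, y) of (t, y) \<Rightarrow> indicator S y * f t)) = measure lborel S * \<bar>f t\<bar>" for t
      by (simp add: abs_mult)
    ultimately show "integrable lborel (\<lambda>t. LINT y|lborel. norm (case (t, y) of (t, y) \<Rightarrow> indicator S y * f t))"
      by simp
    show "AE t in lborel. integrable lborel (\<lambda>y. case (t, y) of (t, y) \<Rightarrow> indicator S y * f t)"
      using S by (intro AE_I2) simp
  qed
  then show ?thesis
  proof (rule Bochner_Integration.integrable_bound)
    show "AE z in lborel \<Otimes>\<^sub>M lborel. norm (case z of (t, y) \<Rightarrow> indicator S y * f t * h t y) \<le> norm (case z of (t, y) \<Rightarrow> indicator S y * f t)"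
      using h by (intro AE_I2) (auto simp: abs_mult mult_left_le split: prod.splits)
  qed measurable
qed

text \<open>Each convolution with the box adds one factor \<open>card_sine (t / 2)\<close> under the
  integral and moves the centre by \<open>1 / 2\<close>, once Fubini has exchanged the
  integrals.\<close>

lemma bspline_fourier:
  assumes "d \<ge> 2"
  shows "bspline d x = 1 / (2 * pi) * (LINT t|lborel. card_sine (t / 2) ^ d * cos (t * (x - real d / 2)))"
  using assms
proof (induction d arbitrary: x rule: dec_induct)
  case base
  then show ?case using bspline_2_fourier by simp
next
  case (step d)
  let ?c = "real d / 2"
  have int: "integrable (lborel \<Otimes>\<^sub>M lborel) (\<lambda>(t, y). indicator {x - 1<..x} y * card_sine (t / 2) ^ d * cos (t * (y - ?c)))"
  proof (rule integrable_pair_window)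
    show "integrable lborel (\<lambda>t. card_sine (t / 2) ^ d)"
      using integrable_card_sine_power[of 0 d] step.hyps by simp
  qed auto
  have eqS: "indicator {0..<1} (x - y) = (indicator {x - 1<..x} y :: real)" for y
    by (auto simp: indicator_def)
  obtain e where e: "d = Suc e" using step.hyps by (cases d) auto
  have "bspline (Suc d) x = (LINT y|lborel. indicator {0..<1} (x - y) * bspline d y)"
    by (simp add: e fun_convolution_def)
  also have "\<dots> = (LINT y|lborel. 1 / (2 * pi) * (LINT t|lborel. indicator {x - 1<..x} y * card_sine (t / 2) ^ d * cos (t * (y - ?c))))"
    by (intro Bochner_Integration.integral_cong refl) (simp add: step.IH eqS mult.assoc)
  also have "\<dots> = 1 / (2 * pi) * (LINT y|lborel. LINT t|lborel. indicator {x - 1<..x} y * card_sine (t / 2) ^ d * cos (t * (y - ?c)))"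
    by (rule integral_mult_right_zero)
  also have "(LINT y|lborel. LINT t|lborel. indicator {x - 1<..x} y * card_sine (t / 2) ^ d * cos (t * (y - ?c)))
     = (LINT t|lborel. LINT y|lborel. indicator {x - 1<..x} y * card_sine (t / 2) ^ d * cos (t * (y - ?c)))"
    by (rule lborel_pair.Fubini_integral[OF int])
  also have "\<dots> = (LINT t|lborel. card_sine (t / 2) ^ Suc d * cos (t * (x - real (Suc d) / 2)))"
  proof (intro Bochner_Integration.integral_cong refl)
    fix t :: real
    have "(LINT y|lborel. indicator {x - 1<..x} y * card_sine (t / 2) ^ d * cos (t * (y - ?c)))
       = (LINT y|lborel. card_sine (t / 2) ^ d * (indicator {0..<1} (x - y) * cos (t * (y - ?c))))"
      by (intro Bochner_Integration.integral_cong refl) (simp add: eqS)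
    also have "\<dots> = card_sine (t / 2) ^ d * (card_sine (t / 2) * cos (t * (x - 1 / 2 - ?c)))"
      by (simp only: integral_mult_right_zero integral_cos_window)
    also have "x - 1 / 2 - ?c = x - real (Suc d) / 2" by (simp add: field_simps)
    finally show "(LINT y|lborel. indicator {x - 1<..x} y * card_sine (t / 2) ^ d * cos (t * (y - ?c)))
       = card_sine (t / 2) ^ Suc d * cos (t * (x - real (Suc d) / 2))" by simp
  qed
  finally show ?case .
qed

section \<open>Derivatives of B-splines\<close>

lemma bspline_Suc:
  "d \<ge> 1 \<Longrightarrow> bspline (Suc d) x = (LINT y|lborel. indicator {0..<1} (x - y) * bspline d y)"
  by (cases d) (auto simp: fun_convolution_def)

lemma bspline_nonneg: "0 \<le> bspline d x"
proof (induction d arbitrary: x)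
  case (Suc d)
  then show ?case by (cases "d = 0") (auto simp: bspline_Suc intro!: Bochner_Integration.integral_nonneg)
qed simp

lemma bspline_eq_0: "x < 0 \<or> real d < x \<Longrightarrow> bspline d x = 0"
proof (induction d arbitrary: x)
  case (Suc d)
  show ?case
  proof (cases "d = 0")
    case False
    have "indicator {0..<1} (x - y) * bspline d y = 0" for y
      using Suc.IH[of y] Suc.prems by (auto simp: indicator_def)
    then have "(LINT y|lborel. indicator {0..<1} (x - y) * bspline d y) = 0" by (simp only: integral_zero)
    then show ?thesis using False by (simp add: bspline_Suc)
  qed (use Suc.prems in \<open>auto simp: indicator_def\<close>)
qed simp

text \<open>By Fubini the mass is multiplied by that of the box, which is 1. With nonnegativity this
  makes every spline a probability density.\<close>

lemma bspline_integral:
  assumes "d \<ge> 1"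
  shows "integrable lborel (bspline d) \<and> (LINT x|lborel. bspline d x) = 1"
  using assms
proof (induction d rule: dec_induct)
  case base
  have "(LINT x|lborel. indicator {0..<1::real} x) = (1::real)" by simp
  moreover have "integrable lborel (indicator {0..<1} :: real \<Rightarrow> real)"
    by (rule integrable_real_indicator) auto
  ultimately show ?case by simp
next
  case (step d)
  have [measurable]: "bspline d \<in> borel_measurable borel" using step.IH by auto
  have shift: "indicator {0..<1} (t - y) = (indicator {y..<y + 1} t :: real)" for t y :: real
    by (auto simp: indicator_def)
  have w: "(LINT t|lborel. indicator {0..<1} (t - y) * c) = c" for y c :: real
    unfolding shift by simp
  have m: "(\<lambda>(y, t). indicator {0..<1} (t - y) * bspline d y) \<in> borel_measurable (lborel \<Otimes>\<^sub>M lborel)"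
    by measurable
  have int: "integrable (lborel \<Otimes>\<^sub>M lborel) (\<lambda>(y, t). indicator {0..<1} (t - y) * bspline d y)"
  proof (rule lborel_pair.Fubini_integrable[OF m])
    have "(LINT t|lborel. norm (case (y, t) of (y, t) \<Rightarrow> indicator {0..<1} (t - y) * bspline d y)) = bspline d y" for y
      using w[of y "bspline d y"] bspline_nonneg[of d y] by (simp add: abs_mult)
    then show "integrable lborel (\<lambda>y. LINT t|lborel. norm (case (y, t) of (y, t) \<Rightarrow> indicator {0..<1} (t - y) * bspline d y))"
      using step.IH by simp
    show "AE y in lborel. integrable lborel (\<lambda>t. case (y, t) of (y, t) \<Rightarrow> indicator {0..<1} (t - y) * bspline d y)"
      unfolding shift by (intro AE_I2) simp
  qed
  have eq: "bspline (Suc d) = (\<lambda>t. LINT y|lborel. indicator {0..<1} (t - y) * bspline d y)"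
    using step.hyps by (intro ext bspline_Suc) auto
  have "(LINT t|lborel. bspline (Suc d) t) = (LINT y|lborel. LINT t|lborel. indicator {0..<1} (t - y) * bspline d y)"
    unfolding eq by (rule lborel_pair.Fubini_integral[OF int])
  also have "\<dots> = 1" using step.IH by (simp only: w)
  finally show ?case using lborel_pair.integrable_snd[OF int] by (simp add: eq)
qed

text \<open>\<open>deriv\<close> depends only on the germ of the function, so no differentiability
  is assumed. This transfers the support of the spline to its derivatives.\<close>

lemma higher_deriv_zero_on_open:
  assumes "open S" "\<And>x. x \<in> S \<Longrightarrow> f x = 0" "x \<in> S"
  shows "(deriv ^^ k) f x = (0::real)"
  using assms(3)
proof (induction k arbitrary: x)
  case (Suc k)
  have "deriv ((deriv ^^ k) f) x = deriv (\<lambda>_. 0) x"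
    using Suc eventually_nhds_in_open[OF assms(1) Suc.prems]
    by (intro deriv_cong_ev) (auto elim: eventually_mono)
  then show ?case by simp
qed (simp add: assms(2))

text \<open>Differentiating \<open>k\<close> times uses moments up to order \<open>k + 1\<close>,
  and a moment of order \<open>j\<close> is integrable for \<open>j + 2 \<le> d\<close>; hence
  \<open>d \<ge> k + 3\<close>.\<close>

lemma higher_deriv_bspline:
  assumes "d \<ge> k + 3"
  shows "(deriv ^^ k) (bspline d) x = 1 / (2 * pi) * cos_transform (\<lambda>t. card_sine (t / 2) ^ d) k (x - real d / 2)"
proof -
  have "bspline d = (\<lambda>x. 1 / (2 * pi) * cos_transform (\<lambda>t. card_sine (t / 2) ^ d) 0 (x - real d / 2))"
    using assms by (intro ext) (simp add: bspline_fourier cos_transform_def)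
  then show ?thesis
    using higher_deriv_cos_transform_shift[of "\<lambda>t. card_sine (t / 2) ^ d" k "1 / (2 * pi)" "real d / 2"]
      integrable_card_sine_power[of _ d] assms by simp
qed

section \<open>Rescaling to unit variance\<close>

text \<open>Substituting \<open>u = r * t\<close>, the factor \<open>t ^ k\<close> yields
  \<open>1 / r ^ k\<close> and the measure yields one more \<open>1 / r\<close>.\<close>

lemma cos_transform_rescale:
  assumes "r > 0" 
  shows "r ^ Suc k * cos_transform g k (r * x) = cos_transform (\<lambda>u. g (u / r)) k x"
proof -
  have "cos_transform g k (r * x)
     = \<bar>1 / r\<bar> *\<^sub>R (LINT u|lborel. g (0 + 1 / r * u) * (0 + 1 / r * u) ^ k * cos ((0 + 1 / r * u) * (r * x) + real k * pi / 2))"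
    unfolding cos_transform_def using assms by (intro lborel_integral_real_affine) auto
  also have "\<dots> = 1 / r * (LINT u|lborel. 1 / r ^ k * (g (u / r) * u ^ k * cos (u * x + real k * pi / 2)))"
    using assms by (simp add: power_divide mult_ac)
  also have "\<dots> = 1 / r ^ Suc k * cos_transform (\<lambda>u. g (u / r)) k x"
    unfolding cos_transform_def by (subst integral_mult_right_zero) simp
  finally show ?thesis using assms by simp
qed

lemma rescaled_bspline_deriv_fourier:
  assumes "d \<ge> k + 3"
  shows "rescaled_bspline_deriv k d x = 1 / (2 * pi) * cos_transform (\<lambda>u. card_sine (u * sqrt (3 / real d)) ^ d) k x"
proof -
  define r where "r = sqrt (real d / 12)"
  have r: "r > 0" using assms by (simp add: r_def)
  have "(real d / 12) powr ((real k + 1) / 2) = r ^ Suc k"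
  proof -
    have "(real d / 12) powr ((real k + 1) / 2) = ((real d / 12) powr (1 / 2)) powr (real (Suc k))"
      by (simp add: powr_powr add.commute)
    also have "\<dots> = r ^ Suc k"
      using r by (subst powr_realpow) (auto simp: powr_half_sqrt r_def)
    finally show ?thesis .
  qed
  moreover have "card_sine (u / r / 2) = card_sine (u * sqrt (3 / real d))" for u
  proof -
    \<comment> \<open>From \<open>r\<^sup>2 = d / 12\<close> one gets
      \<open>(2 * r)\<^sup>2 = d / 3\<close>.\<close>
    have "1 / r / 2 = sqrt (3 / real d)"
    proof (rule real_sqrt_unique[symmetric])
      show "(1 / r / 2)\<^sup>2 = 3 / real d" using assms by (simp add: r_def power_divide)
    qed (use r in simp)
    then have "u / r / 2 = u * sqrt (3 / real d)" by (metis times_divide_eq_right mult.right_neutral)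
    then show ?thesis by simp
  qed
  ultimately show ?thesis
    using cos_transform_rescale[OF r, of k "\<lambda>t. card_sine (t / 2) ^ d" x] assms
    by (simp add: rescaled_bspline_deriv_def higher_deriv_bspline flip: r_def)
qed

section \<open>The Gaussian limit as a cosine transform\<close>

definition gauss_deriv :: "nat \<Rightarrow> real \<Rightarrow> real" where
  "gauss_deriv k x = 1 / sqrt (2 * pi) * (deriv ^^ k) (\<lambda>t::real. exp (- t\<^sup>2 / 2)) x"

lemma integrable_gaussian_moment: "integrable lborel (\<lambda>t::real. exp (- t\<^sup>2 / 2) * t ^ j)"
  using quad_decay_integrable[OF quad_decay_gaussian[of "1/2" j]] by (simp add: mult.commute)

text \<open>Self-duality of the Gaussian, read off from the characteristic function of the standard
  normal distribution.\<close>

lemma gaussian_fourier: "exp (- x\<^sup>2 / 2) = 1 / sqrt (2 * pi) * cos_transform (\<lambda>t. exp (- t\<^sup>2 / 2)) 0 (x :: real)"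
proof -
  have i: "integrable lborel (\<lambda>t. std_normal_density t *\<^sub>R iexp (x * t))"
    by (rule Bochner_Integration.integrable_bound[OF integrable_normal_density[where \<mu> = 0 and \<sigma> = 1]]) (auto simp: norm_mult)
  have "complex_of_real (exp (- x\<^sup>2 / 2)) = (CLINT t|std_normal_distribution. iexp (x * t))"
    using char_std_normal_distribution unfolding char_def by metis
  also have "\<dots> = (CLINT t|lborel. std_normal_density t *\<^sub>R iexp (x * t))"
    by (intro integral_density) auto
  finally have "exp (- x\<^sup>2 / 2) = Re (CLINT t|lborel. std_normal_density t *\<^sub>R iexp (x * t))"
    by (metis Re_complex_of_real)
  also have "\<dots> = (LINT t|lborel. Re (std_normal_density t *\<^sub>R iexp (x * t)))"
    by (rule integral_Re[OF i, symmetric])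
  also have "\<dots> = (LINT t|lborel. 1 / sqrt (2 * pi) * (exp (- t\<^sup>2 / 2) * t ^ 0 * cos (t * x + real 0 * pi / 2)))"
    by (intro Bochner_Integration.integral_cong refl) (simp add: std_normal_density_def Re_exp mult.commute)
  also have "\<dots> = 1 / sqrt (2 * pi) * cos_transform (\<lambda>t. exp (- t\<^sup>2 / 2)) 0 x"
    unfolding cos_transform_def by (rule integral_mult_right_zero)
  finally show ?thesis .
qed

text \<open>The normalising constant and the one from self-duality multiply to
  \<open>1 / (2 * pi)\<close>, the same constant as on the spline side, so the two transforms can be
  subtracted directly.\<close>

lemma gauss_deriv_fourier: "gauss_deriv k x = 1 / (2 * pi) * cos_transform (\<lambda>t. exp (- t\<^sup>2 / 2)) k x"
proof -
  let ?g = "\<lambda>t::real. exp (- t\<^sup>2 / 2)"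
  have "(deriv ^^ k) ?g = (deriv ^^ k) (\<lambda>x. 1 / sqrt (2 * pi) * cos_transform ?g 0 (x - 0))"
    by (rule arg_cong[where f = "deriv ^^ k"], rule ext, simp only: diff_0_right) (rule gaussian_fourier)
  also have "\<dots> = (\<lambda>x. 1 / sqrt (2 * pi) * cos_transform ?g k (x - 0))"
    by (intro higher_deriv_cos_transform_shift integrable_gaussian_moment) auto
  finally have "(deriv ^^ k) ?g x = 1 / sqrt (2 * pi) * cos_transform ?g k x" by simp
  then show ?thesis by (simp add: gauss_deriv_def)
qed

text \<open>The difference from the Gaussian has quadratic decay by the rate estimate; adding back
  the Gaussian moment keeps integrability.\<close>

lemma integrable_rescaled_card_sine_power:
  assumes "d \<ge> j + 3"
  shows "integrable lborel (\<lambda>u. card_sine (u * sqrt (3 / real d)) ^ d * u ^ j)"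
proof -
  obtain C where C: "\<And>d u. d \<ge> j + 3 \<Longrightarrow>
    \<bar>u\<bar> ^ j * \<bar>card_sine (u * sqrt (3 / real d)) ^ d - exp (- u\<^sup>2 / 2)\<bar> \<le> C / real d / (1 + u\<^sup>2)"
    using card_sine_power_gaussian_rate[of j] by metis
  have "quad_decay (\<lambda>u. (card_sine (u * sqrt (3 / real d)) ^ d - exp (- u\<^sup>2 / 2)) * u ^ j)"
    using C[OF assms] by (intro quad_decayI[of _ "C / real d"]) (simp add: abs_mult power_abs mult.commute)
  then have "integrable lborel (\<lambda>u. (card_sine (u * sqrt (3 / real d)) ^ d - exp (- u\<^sup>2 / 2)) * u ^ j)"
    by (rule quad_decay_integrable) auto
  from Bochner_Integration.integrable_add[OF this integrable_gaussian_moment[of j]] show ?thesis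
    by (simp add: algebra_simps)
qed

section \<open>The uniform rate\<close>

text \<open>The cosine is at most 1 in absolute value, so the difference of the transforms is
  bounded, uniformly in \<open>x\<close>, by the integral of the weighted difference of the two
  weights.\<close>

lemma rescaled_bspline_deriv_rate:
  obtains C where "0 \<le> C" "\<And>d x. d \<ge> k + 3 \<Longrightarrow> \<bar>rescaled_bspline_deriv k d x - gauss_deriv k x\<bar> \<le> C / real d"
proof -
  obtain C where C0: "0 \<le> C" and C: "\<And>d u. d \<ge> k + 3 \<Longrightarrow>
    \<bar>u\<bar> ^ k * \<bar>card_sine (u * sqrt (3 / real d)) ^ d - exp (- u\<^sup>2 / 2)\<bar> \<le> C / real d / (1 + u\<^sup>2)"
    using card_sine_power_gaussian_rate[of k] by metis
  have "\<bar>rescaled_bspline_deriv k d x - gauss_deriv k x\<bar> \<le> (C / 2) / real d" if d: "d \<ge> k + 3" for d x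
  proof -
    let ?s = "\<lambda>u. card_sine (u * sqrt (3 / real d)) ^ d" and ?e = "\<lambda>u::real. exp (- u\<^sup>2 / 2)"
    have i1: "integrable lborel (\<lambda>u. ?s u * u ^ k * cos (u * x + real k * pi / 2))"
      by (intro integrable_times_cos integrable_rescaled_card_sine_power d)
    have i2: "integrable lborel (\<lambda>u. ?e u * u ^ k * cos (u * x + real k * pi / 2))"
      by (intro integrable_times_cos integrable_gaussian_moment)
    have eq: "cos_transform ?s k x - cos_transform ?e k x
       = (LINT u|lborel. ?s u * u ^ k * cos (u * x + real k * pi / 2) - ?e u * u ^ k * cos (u * x + real k * pi / 2))"
      unfolding cos_transform_def by (rule Bochner_Integration.integral_diff[OF i1 i2, symmetric])
    have "\<bar>cos_transform ?s k x - cos_transform ?e k x\<bar> \<le> (LINT u|lborel. C / real d / (1 + u\<^sup>2))"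
      unfolding eq
    proof (rule integral_abs_bound_integral)
      fix u :: real
      have "?s u * u ^ k * cos (u * x + real k * pi / 2) - ?e u * u ^ k * cos (u * x + real k * pi / 2)
        = (u ^ k * (?s u - ?e u)) * cos (u * x + real k * pi / 2)" by (simp add: algebra_simps)
      then have "\<bar>?s u * u ^ k * cos (u * x + real k * pi / 2) - ?e u * u ^ k * cos (u * x + real k * pi / 2)\<bar>
        \<le> \<bar>u ^ k * (?s u - ?e u)\<bar>" by (simp add: abs_mult mult_left_le)
      also have "\<dots> \<le> C / real d / (1 + u\<^sup>2)" using C[OF d, of u] by (simp add: abs_mult power_abs)
      finally show "\<bar>?s u * u ^ k * cos (u * x + real k * pi / 2) - ?e u * u ^ k * cos (u * x + real k * pi / 2)\<bar>
        \<le> C / real d / (1 + u\<^sup>2)" .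
    qed (intro Bochner_Integration.integrable_diff i1 i2 integrable_inverse_one_plus_square)+
    then have *: "\<bar>cos_transform ?s k x - cos_transform ?e k x\<bar> \<le> C / real d * pi"
      by (simp only: integral_inverse_one_plus_square)
    have "rescaled_bspline_deriv k d x - gauss_deriv k x = 1 / (2 * pi) * (cos_transform ?s k x - cos_transform ?e k x)"
      unfolding rescaled_bspline_deriv_fourier[OF d] gauss_deriv_fourier by (simp add: right_diff_distrib)
    then have "\<bar>rescaled_bspline_deriv k d x - gauss_deriv k x\<bar> = 1 / (2 * pi) * \<bar>cos_transform ?s k x - cos_transform ?e k x\<bar>"
      by (simp add: abs_mult)
    \<comment> \<open>The \<open>pi\<close> from integrating \<open>1 / (1 + u\<^sup>2)\<close>
      cancels, which leaves \<open>C / 2\<close>.\<close>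
    also have "\<dots> \<le> 1 / (2 * pi) * (C / real d * pi)" using * by (intro mult_left_mono) auto
    finally show ?thesis by simp
  qed
  with C0 show ?thesis by (intro that[of "C / 2"]) auto
qed

text \<open>Differentiating the transform of order \<open>k\<close> needs moments up to
  \<open>k + 2\<close>, and a moment of order \<open>j\<close> is available for
  \<open>d \<ge> j + 3\<close>; hence \<open>k + 5\<close>.\<close>

lemma rescaled_bspline_deriv_has_deriv:
  assumes "d \<ge> k + 5"
  shows "(rescaled_bspline_deriv k d has_real_derivative rescaled_bspline_deriv (Suc k) d x) (at x)"
proof -
  have "rescaled_bspline_deriv k d = (\<lambda>x. 1 / (2 * pi) * cos_transform (\<lambda>u. card_sine (u * sqrt (3 / real d)) ^ d) k x)"
    using assms by (intro ext rescaled_bspline_deriv_fourier) auto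
  moreover have "rescaled_bspline_deriv (Suc k) d x = 1 / (2 * pi) * cos_transform (\<lambda>u. card_sine (u * sqrt (3 / real d)) ^ d) (Suc k) x"
    using assms by (intro rescaled_bspline_deriv_fourier) auto
  ultimately show ?thesis
    using assms
    by (simp only:) (intro DERIV_cmult cos_transform_deriv integrable_rescaled_card_sine_power, auto)
qed

lemma gauss_deriv_has_deriv: "(gauss_deriv k has_real_derivative gauss_deriv (Suc k) x) (at x)"
  unfolding gauss_deriv_fourier[abs_def]
  by (intro DERIV_cmult cos_transform_deriv integrable_gaussian_moment) auto

section \<open>Decay of both families of derivatives\<close>

text \<open>Every derivative is a polynomial times the Gaussian, the polynomials being the Hermite
  polynomials up to sign with recursion \<open>pderiv p - [:0, 1:] * p\<close>.\<close>

lemma quad_decay_gauss_deriv: "quad_decay (gauss_deriv k)"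
proof -
  have "\<exists>p. (deriv ^^ k) (\<lambda>t::real. exp (- t\<^sup>2 / 2)) = (\<lambda>x. poly p x * exp (- x\<^sup>2 / 2))"
  proof (induction k)
    case 0
    show ?case by (rule exI[of _ 1]) simp
  next
    case (Suc k)
    then obtain p where p: "(deriv ^^ k) (\<lambda>t::real. exp (- t\<^sup>2 / 2)) = (\<lambda>x. poly p x * exp (- x\<^sup>2 / 2))" by blast
    have "((\<lambda>x. poly p x * exp (- x\<^sup>2 / 2)) has_real_derivative poly (pderiv p - [:0, 1:] * p) x * exp (- x\<^sup>2 / 2)) (at x)" for x
      by (auto intro!: derivative_eq_intros simp: algebra_simps)
    then have "(deriv ^^ Suc k) (\<lambda>t::real. exp (- t\<^sup>2 / 2)) = (\<lambda>x. poly (pderiv p - [:0, 1:] * p) x * exp (- x\<^sup>2 / 2))"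
      unfolding funpow.simps o_apply p by (intro ext DERIV_imp_deriv)
    then show ?case by blast
  qed
  then obtain p where p: "(deriv ^^ k) (\<lambda>t::real. exp (- t\<^sup>2 / 2)) = (\<lambda>x. poly p x * exp (- x\<^sup>2 / 2))" by blast
  \<comment> \<open>The extra power \<open>x ^ n\<close> lets the induction over the coefficients of
    \<open>p\<close> go through, since splitting off the constant coefficient leaves a factor
    \<open>x\<close>.\<close>
  have "quad_decay (\<lambda>x. x ^ n * poly p x * exp (- x\<^sup>2 / 2))" for n
  proof (induction p arbitrary: n)
    case 0
    show ?case by (rule quad_decayI[of _ 0]) simp
  next
    case (pCons a p)
    have "quad_decay (\<lambda>x. a * (x ^ n * exp (- (1 / 2 * x\<^sup>2))) + x ^ Suc n * poly p x * exp (- x\<^sup>2 / 2))"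
      by (intro quad_decay_add quad_decay_cmult quad_decay_gaussian pCons.IH) auto
    then show ?case by (simp add: algebra_simps)
  qed
  from quad_decay_cmult[OF this[of 0], of "1 / sqrt (2 * pi)"] show ?thesis
    unfolding gauss_deriv_def[abs_def] p by simp
qed

lemma quad_decay_compact_support:
  fixes f :: "real \<Rightarrow> real"
  assumes "continuous_on UNIV f" "\<And>x. \<bar>x\<bar> > R \<Longrightarrow> f x = 0"
  shows "quad_decay f"
proof -
  have "bounded ((\<lambda>x. (1 + x\<^sup>2) * f x) ` {-R..R})"
    by (intro compact_imp_bounded compact_continuous_image continuous_intros continuous_on_subset[OF assms(1)]) auto
  then obtain B where B: "0 < B" "\<And>x. x \<in> {-R..R} \<Longrightarrow> \<bar>(1 + x\<^sup>2) * f x\<bar> \<le> B"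
    unfolding bounded_pos by auto
  have "(1 + x\<^sup>2) * \<bar>f x\<bar> \<le> B" for x
    using B(1) B(2)[of x] assms(2)[of x] one_plus_square_pos[of x] by (cases "\<bar>x\<bar> > R") (auto simp: abs_mult not_less abs_le_iff)
  then show ?thesis
    by (intro quad_decayI[of _ B]) (simp add: pos_le_divide_eq one_plus_square_pos mult.commute)
qed

text \<open>A continuous function of compact support: the spline vanishes on the open complement of
  \<open>{0..d}\<close>, hence so do its derivatives, and the rescaling maps this interval to the
  one centred at 0 with half-length \<open>(d / 2) / r\<close>.\<close>

lemma quad_decay_rescaled_bspline_deriv:
  assumes "d \<ge> k + 5"
  shows "quad_decay (rescaled_bspline_deriv k d)"
proof (rule quad_decay_compact_support)
  define r where "r = sqrt (real d / 12)"
  have r: "r > 0" using assms by (simp add: r_def)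
  show "continuous_on UNIV (rescaled_bspline_deriv k d)"
    using rescaled_bspline_deriv_has_deriv[OF assms] by (intro continuous_at_imp_continuous_on ballI DERIV_isCont)
  fix x assume "\<bar>x\<bar> > (real d / 2) / r"
  then have "\<bar>r * x\<bar> > real d / 2" using r by (simp add: field_simps abs_mult)
  then have "r * x + real d / 2 \<in> {..<0} \<union> {real d<..}" by (auto simp: abs_if split: if_splits)
  then have "(deriv ^^ k) (bspline d) (r * x + real d / 2) = 0"
    by (rule higher_deriv_zero_on_open[rotated 2]) (auto simp: bspline_eq_0)
  then show "rescaled_bspline_deriv k d x = 0" by (simp add: rescaled_bspline_deriv_def r_def)
qed

section \<open>Convergence in the mean\<close>

text \<open>The product \<open>f x * g x\<close> vanishes at both ends, so its derivative integrates
  to 0; decay of all four functions makes the two parts separately integrable.\<close>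

lemma quad_decay_by_parts:
  assumes f: "\<And>x. (f has_real_derivative f' x) (at x)" and g: "\<And>x. (g has_real_derivative g' x) (at x)"
    and cont: "continuous_on UNIV f'" "continuous_on UNIV g'"
    and decay: "quad_decay f" "quad_decay f'" "quad_decay g" "quad_decay g'"
  shows "(LINT x|lborel. f x * g' x) = - (LINT x|lborel. f' x * g x)"
proof -
  have cf: "continuous_on UNIV f" "continuous_on UNIV g"
    using f g by (auto intro!: continuous_at_imp_continuous_on DERIV_isCont)
  have [measurable]: "f \<in> borel_measurable borel" "g \<in> borel_measurable borel"
      "f' \<in> borel_measurable borel" "g' \<in> borel_measurable borel"
    using cf cont by (auto intro: borel_measurable_continuous_onI)
  have i1: "integrable lborel (\<lambda>x. f' x * g x)" and i2: "integrable lborel (\<lambda>x. f x * g' x)"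
    by (rule quad_decay_integrable; (intro quad_decay_mult decay)?; measurable)+
  have lim: "((\<lambda>x. f x * g x) \<longlongrightarrow> 0) at_top" "((\<lambda>x. f x * g x) \<longlongrightarrow> 0) at_bot"
    by (intro quad_decay_tendsto_0 quad_decay_mult decay; simp add: at_infinity_eq_at_top_bot)+
  have "(LBINT x=-\<infinity>..\<infinity>. f' x * g x + f x * g' x) = 0 - 0"
  proof (rule interval_integral_FTC_integrable[where F = "\<lambda>x. f x * g x"])
    fix x :: real
    have "((\<lambda>x. f x * g x) has_real_derivative f' x * g x + f x * g' x) (at x)"
      using DERIV_mult[OF f g, of x] by (simp add: algebra_simps)
    then show "((\<lambda>x. f x * g x) has_vector_derivative f' x * g x + f x * g' x) (at x)"
      by (simp add: has_real_derivative_iff_has_vector_derivative)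
    show "isCont (\<lambda>x. f' x * g x + f x * g' x) x"
      using cf cont by (auto intro!: continuous_intros simp: continuous_on_eq_continuous_at)
  qed (use i1 i2 lim in \<open>auto simp: set_integrable_def ereal_tendsto_simps\<close>)
  then have "(LINT x|lborel. f' x * g x + f x * g' x) = 0"
    by (simp add: interval_lebesgue_integral_def set_lebesgue_integral_def)
  then show ?thesis using i1 i2 by simp
qed

lemma derivative_chain_square_integral:
  assumes deriv: "\<And>j x. j < 2 * k \<Longrightarrow> (U j has_real_derivative U (Suc j) x) (at x)"
    and decay: "\<And>j. j \<le> 2 * k \<Longrightarrow> quad_decay (U j)"
    and cont: "continuous_on UNIV (U (2 * k))"
  shows "(LINT x|lborel. U k x * U k x) = (- 1) ^ k * (LINT x|lborel. U 0 x * U (2 * k) x)"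
proof -
  have c: "continuous_on UNIV (U j)" if "j \<le> 2 * k" for j
  proof (cases "j = 2 * k")
    case False
    then show ?thesis using that deriv[of j] by (auto intro!: continuous_at_imp_continuous_on DERIV_isCont)
  qed (use cont in simp)
  \<comment> \<open>One integration by parts per step moves a derivative from the left factor to the
    right one and flips the sign; \<open>i = k\<close> is the claim.\<close>
  have "i \<le> k \<Longrightarrow> (LINT x|lborel. U k x * U k x) = (- 1) ^ i * (LINT x|lborel. U (k - i) x * U (k + i) x)" for i
  proof (induction i)
    case (Suc i)
    define m where "m = k - Suc i"
    have m: "k - i = Suc m" "m < 2 * k" "Suc m \<le> 2 * k" using Suc.prems by (auto simp: m_def)
    have "(LINT x|lborel. U m x * U (Suc (k + i)) x) = - (LINT x|lborel. U (Suc m) x * U (k + i) x)"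
      using Suc.prems m by (intro quad_decay_by_parts deriv c decay) auto
    then have "(LINT x|lborel. U (k - i) x * U (k + i) x) = - (LINT x|lborel. U (k - Suc i) x * U (k + Suc i) x)"
      by (simp add: m(1) flip: m_def)
    then show ?case using Suc by simp
  qed simp
  from this[of k] show ?thesis by (simp add: mult_2)
qed

section \<open>Membership and convergence in the Lebesgue spaces\<close>

text \<open>For \<open>p \<ge> 1\<close> the denominator only improves, as
  \<open>(1 + x\<^sup>2) powr p\<close> is at least \<open>1 + x\<^sup>2\<close>.\<close>

lemma in_Lp_quad_decay:
  assumes "quad_decay f" and [measurable]: "f \<in> borel_measurable borel" and p: "p \<ge> 1"
  shows "in_Lp p lborel f"
proof -
  obtain C where C: "\<And>x. \<bar>f x\<bar> \<le> C / (1 + x\<^sup>2)" using assms(1) unfolding quad_decay_def by blast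
  have C0: "0 \<le> C" using C[of 0] by simp
  have "\<bar>\<bar>f x\<bar> powr p\<bar> \<le> C powr p / (1 + x\<^sup>2)" for x
  proof -
    have "\<bar>f x\<bar> powr p \<le> (C / (1 + x\<^sup>2)) powr p" using p C by (intro powr_mono2) auto
    also have "\<dots> = C powr p / (1 + x\<^sup>2) powr p" using C0 one_plus_square_pos[of x] by (intro powr_divide)
    also have "\<dots> \<le> C powr p / (1 + x\<^sup>2)"
    proof (rule divide_left_mono)
      have "(1 + x\<^sup>2) powr 1 \<le> (1 + x\<^sup>2) powr p" using p by (intro powr_mono) auto
      then show "1 + x\<^sup>2 \<le> (1 + x\<^sup>2) powr p" using one_plus_square_pos[of x] by simp
    qed (use one_plus_square_pos[of x] in auto)
    finally show ?thesis by simp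
  qed
  then have "integrable lborel (\<lambda>x. \<bar>f x\<bar> powr p)"
    by (intro quad_decay_integrable quad_decayI) auto
  then show ?thesis by (simp add: in_Lp_def)
qed

lemma rescaled_bspline_abs_integral:
  assumes "d \<ge> 1"
  shows "integrable lborel (rescaled_bspline_deriv 0 d) \<and> (LINT x|lborel. \<bar>rescaled_bspline_deriv 0 d x\<bar>) = 1"
proof -
  define r where "r = sqrt (real d / 12)"
  have r: "r > 0" using assms by (simp add: r_def)
  have eq: "rescaled_bspline_deriv 0 d x = r * bspline d (real d / 2 + r * x)" for x
    by (simp add: rescaled_bspline_deriv_def r_def powr_half_sqrt add.commute)
  have B: "integrable lborel (bspline d)" "(LINT x|lborel. bspline d x) = 1"
    using bspline_integral[OF assms] by auto
  have "(LINT x|lborel. bspline d x) = \<bar>r\<bar> *\<^sub>R (LINT x|lborel. bspline d (real d / 2 + r * x))"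
    using r by (intro lborel_integral_real_affine) auto
  then have "(LINT x|lborel. r * bspline d (real d / 2 + r * x)) = 1" using r B by simp
  moreover have "integrable lborel (\<lambda>x. bspline d (real d / 2 + r * x))"
    using r B by (intro lborel_integrable_real_affine) auto
  ultimately show ?thesis
    using r bspline_nonneg[of d] unfolding eq[abs_def] by (simp add: abs_mult)
qed

lemma gauss_abs_integral: "integrable lborel (gauss_deriv 0) \<and> (LINT x|lborel. \<bar>gauss_deriv 0 x\<bar>) = 1"
proof -
  have "gauss_deriv 0 = std_normal_density"
    by (auto simp: gauss_deriv_def std_normal_density_def)
  then show ?thesis by simp
qed

lemma rescaled_bspline_deriv_measurable:
  assumes "d \<ge> k + 5" shows "rescaled_bspline_deriv k d \<in> borel_measurable borel"
  using rescaled_bspline_deriv_has_deriv[OF assms]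
  by (intro borel_measurable_continuous_onI continuous_at_imp_continuous_on ballI DERIV_isCont)

lemma gauss_deriv_measurable: "gauss_deriv k \<in> borel_measurable borel"
  using gauss_deriv_has_deriv
  by (intro borel_measurable_continuous_onI continuous_at_imp_continuous_on ballI DERIV_isCont)

text \<open>All derivatives are moved onto one factor. The underived factor has absolute integral at
  most 2 as a difference of two densities, and the factor of order \<open>2 * k\<close> is uniformly
  \<open>O(1 / d)\<close>.\<close>

lemma rescaled_bspline_deriv_L2_rate:
  obtains C where "\<And>d. d \<ge> 2 * k + 5 \<Longrightarrow>
    (LINT x|lborel. (rescaled_bspline_deriv k d x - gauss_deriv k x)\<^sup>2) \<le> C / real d"
proof -
  obtain C where C: "0 \<le> C" "\<And>d x. d \<ge> 2 * k + 3 \<Longrightarrow>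
      \<bar>rescaled_bspline_deriv (2 * k) d x - gauss_deriv (2 * k) x\<bar> \<le> C / real d"
    using rescaled_bspline_deriv_rate[of "2 * k"] by metis
  have "(LINT x|lborel. (rescaled_bspline_deriv k d x - gauss_deriv k x)\<^sup>2) \<le> 2 * C / real d"
    if d: "d \<ge> 2 * k + 5" for d
  proof -
    define U where "U = (\<lambda>j x. rescaled_bspline_deriv j d x - gauss_deriv j x)"
    \<comment> \<open>The range includes \<open>j = 2 * k\<close>, so that the top function is
      differentiable and hence continuous and measurable; this is why
      \<open>d \<ge> 2 * k + 5\<close>.\<close>
    have dU: "(U j has_real_derivative U (Suc j) x) (at x)" if "j \<le> 2 * k" for j x
      unfolding U_def using that d
      by (intro DERIV_diff rescaled_bspline_deriv_has_deriv gauss_deriv_has_deriv) auto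
    have qU: "quad_decay (U j)" if "j \<le> 2 * k" for j
      unfolding U_def using that d
      by (intro quad_decay_diff quad_decay_rescaled_bspline_deriv quad_decay_gauss_deriv) auto
    have "(LINT x|lborel. U k x * U k x) = (- 1) ^ k * (LINT x|lborel. U 0 x * U (2 * k) x)"
      using dU qU by (intro derivative_chain_square_integral) (auto intro!: continuous_at_imp_continuous_on DERIV_isCont)
    also have "\<dots> \<le> \<bar>LINT x|lborel. U 0 x * U (2 * k) x\<bar>"
      by (rule order_trans[OF abs_ge_self]) (simp add: abs_mult)
    also have "\<dots> \<le> (LINT x|lborel. (\<bar>rescaled_bspline_deriv 0 d x\<bar> + \<bar>gauss_deriv 0 x\<bar>) * (C / real d))"
    proof (rule integral_abs_bound_integral)
      have [measurable]: "U 0 \<in> borel_measurable borel" "U (2 * k) \<in> borel_measurable borel"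
        using dU by (auto intro!: borel_measurable_continuous_onI continuous_at_imp_continuous_on DERIV_isCont)
      show "integrable lborel (\<lambda>x. U 0 x * U (2 * k) x)"
        by (intro quad_decay_integrable quad_decay_mult qU) auto
      show "integrable lborel (\<lambda>x. (\<bar>rescaled_bspline_deriv 0 d x\<bar> + \<bar>gauss_deriv 0 x\<bar>) * (C / real d))"
        using rescaled_bspline_abs_integral[of d] gauss_abs_integral d by auto
      fix x
      show "\<bar>U 0 x * U (2 * k) x\<bar> \<le> (\<bar>rescaled_bspline_deriv 0 d x\<bar> + \<bar>gauss_deriv 0 x\<bar>) * (C / real d)"
        unfolding abs_mult U_def using C(2)[of d x] d by (intro mult_mono abs_triangle_ineq4) auto
    qed
    also have "\<dots> = (LINT x|lborel. \<bar>rescaled_bspline_deriv 0 d x\<bar> + \<bar>gauss_deriv 0 x\<bar>) * (C / real d)"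
      by (rule integral_mult_left_zero)
    also have "\<dots> = 2 * C / real d"
      using rescaled_bspline_abs_integral[of d] gauss_abs_integral d by simp
    finally show ?thesis by (simp add: U_def power2_eq_square)
  qed
  then show ?thesis by (rule that)
qed

lemma rescaled_bspline_deriv_converges_in_Lp:
  assumes p: "p \<ge> 2"
  shows "converges_in_Lp p lborel (rescaled_bspline_deriv k) (gauss_deriv k)"
proof -
  obtain C where C: "\<And>d x. d \<ge> k + 3 \<Longrightarrow> \<bar>rescaled_bspline_deriv k d x - gauss_deriv k x\<bar> \<le> C / real d"
    using rescaled_bspline_deriv_rate[of k] by metis
  obtain D where D: "\<And>d. d \<ge> 2 * k + 5 \<Longrightarrow>
    (LINT x|lborel. (rescaled_bspline_deriv k d x - gauss_deriv k x)\<^sup>2) \<le> D / real d"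
    using rescaled_bspline_deriv_L2_rate[of k] by metis
  note [measurable] = gauss_deriv_measurable
  have g: "in_Lp p lborel (gauss_deriv k)"
    using p by (intro in_Lp_quad_decay quad_decay_gauss_deriv gauss_deriv_measurable) auto
  have b: "in_Lp p lborel (rescaled_bspline_deriv k d)" if "d \<ge> k + 5" for d
    using p that by (intro in_Lp_quad_decay quad_decay_rescaled_bspline_deriv rescaled_bspline_deriv_measurable) auto
  have bound: "Lp_norm p lborel (\<lambda>x. rescaled_bspline_deriv k d x - gauss_deriv k x) \<le> (D / real d) powr (1 / p)"
    if d: "d \<ge> 2 * k + 5" "real d \<ge> C" for d
  proof -
    let ?h = "\<lambda>x. rescaled_bspline_deriv k d x - gauss_deriv k x"
    have hm [measurable]: "?h \<in> borel_measurable borel"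
      using rescaled_bspline_deriv_measurable[of k d] d by (intro borel_measurable_diff gauss_deriv_measurable) auto
    have hq: "quad_decay ?h"
      using d by (intro quad_decay_diff quad_decay_rescaled_bspline_deriv quad_decay_gauss_deriv) auto
    have "(LINT x|lborel. \<bar>?h x\<bar> powr p) \<le> (LINT x|lborel. (?h x)\<^sup>2)"
    proof (rule integral_mono)
      show "integrable lborel (\<lambda>x. \<bar>?h x\<bar> powr p)"
        using in_Lp_quad_decay[OF hq hm, of p] p by (simp add: in_Lp_def)
      show "integrable lborel (\<lambda>x. (?h x)\<^sup>2)"
        unfolding power2_eq_square by (intro quad_decay_integrable quad_decay_mult hq) measurable
      fix x
      \<comment> \<open>Once the uniform error is at most 1, raising the exponent from 2 to
        \<open>p\<close> can only decrease the integrand.\<close>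
      have "C / real d \<le> 1" using d by (simp add: divide_le_eq)
      then have "\<bar>?h x\<bar> \<le> 1" using C[of d x] d by linarith
      then have "\<bar>?h x\<bar> powr p \<le> \<bar>?h x\<bar> powr 2" using p by (intro powr_mono') auto
      then show "\<bar>?h x\<bar> powr p \<le> (?h x)\<^sup>2" by (simp add: powr_numeral)
    qed
    also have "\<dots> \<le> D / real d" using D d by simp
    finally show ?thesis unfolding Lp_norm_def using p by (intro powr_mono2 Bochner_Integration.integral_nonneg) auto
  qed
  have "(\<lambda>d. Lp_norm p lborel (\<lambda>x. rescaled_bspline_deriv k d x - gauss_deriv k x)) \<longlonglongrightarrow> 0"
  proof (rule tendsto_sandwich)
    show "\<forall>\<^sub>F d in sequentially. 0 \<le> Lp_norm p lborel (\<lambda>x. rescaled_bspline_deriv k d x - gauss_deriv k x)"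
      by (simp add: Lp_norm_def)
    obtain N where N: "C \<le> real N" using real_arch_simple by blast
    show "\<forall>\<^sub>F d in sequentially. Lp_norm p lborel (\<lambda>x. rescaled_bspline_deriv k d x - gauss_deriv k x) \<le> (D / real d) powr (1 / p)"
      using eventually_ge_at_top[of "max N (2 * k + 5)"] by eventually_elim (use N in \<open>auto intro!: bound\<close>)
    \<comment> \<open>The sign of \<open>D\<close> follows from the nonnegative integral at the
      smallest admissible order; it keeps the base of \<open>powr\<close> nonnegative as it tends to
      0.\<close>
    have "0 \<le> D / real (2 * k + 5)"
      by (rule order_trans[OF _ D]) (auto intro!: Bochner_Integration.integral_nonneg)
    then have D0: "0 \<le> D" by (simp add: zero_le_divide_iff)
    have "(\<lambda>d. D / real d) \<longlonglongrightarrow> 0" by real_asymp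
    then show "(\<lambda>d. (D / real d) powr (1 / p)) \<longlonglongrightarrow> 0"
      using p D0 by (intro tendsto_eq_intros tendsto_powr'[where a = 0 and b = "1 / p", THEN tendsto_eq_rhs]) auto
  qed simp
  then show ?thesis
    unfolding converges_in_Lp_def using g eventually_mono[OF eventually_ge_at_top[of "k + 5"] b] by simp
qed

theorem theorem1:
  fixes k :: nat
  shows "(\<exists>C. \<forall>d>k + 2. \<forall>x::real.
            \<bar>rescaled_bspline_deriv k d x -
              1 / sqrt (2 * pi) * (deriv ^^ k) (\<lambda>t::real. exp (- t\<^sup>2 / 2)) x\<bar> \<le> C / real d) \<and>
         (\<forall>x::real. (\<lambda>d. rescaled_bspline_deriv k d x)
            \<longlonglongrightarrow> 1 / sqrt (2 * pi) * (deriv ^^ k) (\<lambda>t::real. exp (- t\<^sup>2 / 2)) x) \<and>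
         (\<forall>p::real. p \<ge> 2 \<longrightarrow>
            converges_in_Lp p lborel (rescaled_bspline_deriv k)
              (\<lambda>x. 1 / sqrt (2 * pi) * (deriv ^^ k) (\<lambda>t::real. exp (- t\<^sup>2 / 2)) x))"
  unfolding gauss_deriv_def[symmetric]
proof (intro conjI allI impI)
  obtain C where C: "\<And>d x. d \<ge> k + 3 \<Longrightarrow> \<bar>rescaled_bspline_deriv k d x - gauss_deriv k x\<bar> \<le> C / real d"
    using rescaled_bspline_deriv_rate[of k] by metis
  then show "\<exists>C. \<forall>d>k + 2. \<forall>x. \<bar>rescaled_bspline_deriv k d x - gauss_deriv k x\<bar> \<le> C / real d"
    by (intro exI[of _ C]) auto
  show "(\<lambda>d. rescaled_bspline_deriv k d x) \<longlonglongrightarrow> gauss_deriv k x" for x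
  proof (rule LIM_zero_cancel, rule Lim_null_comparison)
    show "\<forall>\<^sub>F d in sequentially. norm (rescaled_bspline_deriv k d x - gauss_deriv k x) \<le> C / real d"
      using eventually_ge_at_top[of "k + 3"] by eventually_elim (use C in simp)
    show "(\<lambda>d. C / real d) \<longlonglongrightarrow> 0" by real_asymp
  qed
  show "converges_in_Lp p lborel (rescaled_bspline_deriv k) (gauss_deriv k)" if "p \<ge> 2" for p
    using that by (rule rescaled_bspline_deriv_converges_in_Lp)
qed

end
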